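(* Let $P_n$ be the path on $n$ vertices. If $n$ is even, then $2\lfloor n/16\rfloor-5\le b^I_g(P_n)\le 4\lceil n/16\rceil-1$. If $n$ is odd, then $2\lfloor n/16\rfloor\le b^I_g(P_n)\le 4\lceil n/16\rceil+4$.
   Context: The balance game on a finite simple graph $G$ is played by two players, Admirable (A) and Impish (I), who alternately select a not-yet-labeled vertex of $G$ until all vertices are labeled; Admirable labels each vertex she selects by $0$ and Impish labels each vertex he selects by $1$. Each edge receives the sum modulo $2$ of the labels of its endpoints. Let $e_0$ and $e_1$ be the numbers of edges labeled $0$ and $1$ at the end; the discrepancy is $d=e_1-e_0$. Admirable tries to minimize $d$ and Impish tries to maximize $d$. $b^I_g(G)$ is the value of $d$ under optimal play of both players when Impish moves first. *)

theory Defs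
  imports Complex_Main
begin

text \<open>A graph is a pair of a vertex set and a set of edges, an edge being a two-element set of
  vertices.\<close>

type_synonym 'a graph = "'a set \<times> 'a set set"

abbreviation verts :: "'a graph \<Rightarrow> 'a set" where
  "verts G \<equiv> fst G"

abbreviation edges :: "'a graph \<Rightarrow> 'a set set" where
  "edges G \<equiv> snd G"

definition finite_simple_graph :: "'a graph \<Rightarrow> bool" where
  "finite_simple_graph G \<longleftrightarrow> finite (verts G) \<and> (\<forall>e\<in>edges G. e \<subseteq> verts G \<and> card e = 2)"

definition path_graph :: "nat \<Rightarrow> nat graph" where
  "path_graph n = ({1..n}, {{i, i + 1} | i. 1 \<le> i \<and> i + 1 \<le> n})"

lemma finite_simple_graph_path_graph: "finite_simple_graph (path_graph n)"
  unfolding finite_simple_graph_def path_graph_def by auto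

text \<open>A position of the game is a partial labeling \<open>L\<close> of the vertices; \<open>dom L\<close> is the set of
  vertices labeled so far.\<close>

type_synonym 'a labeling = "'a \<Rightarrow> nat option"

definition edge_label :: "'a labeling \<Rightarrow> 'a set \<Rightarrow> nat" where
  "edge_label L e = (\<Sum>v\<in>e. the (L v)) mod 2"

definition discrepancy :: "'a graph \<Rightarrow> 'a labeling \<Rightarrow> int" where
  "discrepancy G L =
     int (card {e \<in> edges G. edge_label L e = 1}) - int (card {e \<in> edges G. edge_label L e = 0})"

datatype player = Admirable | Impish

text \<open>\<open>game_value G p L\<close> is the final discrepancy under optimal play of both players, continuing
  from position \<open>L\<close> with player \<open>p\<close> to move. The finiteness test only serves to make the
  recursion terminate.\<close>

function game_value :: "'a graph \<Rightarrow> player \<Rightarrow> 'a labeling \<Rightarrow> int" where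
  "game_value G p L =
     (if finite (verts G) \<and> verts G - dom L \<noteq> {} then
        (case p of
           Admirable \<Rightarrow> Min ((\<lambda>v. game_value G Impish (L(v \<mapsto> 0))) ` (verts G - dom L))
         | Impish \<Rightarrow> Max ((\<lambda>v. game_value G Admirable (L(v \<mapsto> 1))) ` (verts G - dom L)))
      else discrepancy G L)"
  by pat_completeness auto
termination
proof (relation "measure (\<lambda>(G, p, L). card (verts G - dom L))", goal_cases)
  case 1
  show ?case by simp
next
  case (2 G p L v)
  then have "card (verts G - dom (L(v \<mapsto> 0))) < card (verts G - dom L)"
    by (intro psubset_card_mono) auto
  then show ?case by simp
next
  case (3 G p L v)
  then have "card (verts G - dom (L(v \<mapsto> 1))) < card (verts G - dom L)"
    by (intro psubset_card_mono) auto
  then show ?case by simp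
qed

declare game_value.simps [simp del]

definition game_balance_I :: "'a graph \<Rightarrow> int" where
  "game_balance_I G = game_value G Impish Map.empty"

end

theory Submission
  imports Defs "HOL-Library.Multiset"
begin

text \<open>Write S for four times the number of edges with both ends labelled 0 plus twice the number of
  ends of the path labelled 0. Since the numbers of zeros and ones are determined by \<open>n\<close>, the final
  discrepancy is \<open>n + 1 - S\<close> for even and \<open>n - 1 - S\<close> for odd \<open>n\<close>. So the game is a scoring
  Maker-Breaker game in which Admirable maximizes S, and in which an additional move never hurts.
  The labelled vertices cut the path into independent segments, and cutting a segment in two, with
  a path end on either side of the cut, costs Admirable at most 2 and Impish nothing. On a path
  with 16 vertices the second player secures S \<open>\<ge>\<close> 14 (as Admirable), respectively S \<open>\<le>\<close> 14 (as
  Impish). Cutting the long path into such blocks and a short remainder, and always answering in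
  the same block, gives the bounds.\<close>

section \<open>Responder strategies\<close>

text \<open>An answer in the same block is impossible once that block is full, and a block of odd
  length shifts the turn. The responder is therefore allowed to pass: this makes guarantees add up
  over disjoint segments, and passes are replaced by real moves only when the path is treated as one
  game again. Since passing would change the number of zeros, on which the discrepancy depends,
  strategies promise a bound on S alone, and the zeros are counted in the real, alternating game. A
  fictitious path end is put at a cut because its weight 1 is the mean of the weights 0 and 2 of a
  label, which keeps the error small in both directions. S is measured against n. A block of 16
  brings Admirable 14 less 2 for its cut, 4 short of its length; Impish holds it to 14, 2 short of
  its length. These are the slopes 4 and 2 of the theorem. Impish, who starts, has one move more
  than a responder. For even n it is merely added to a responder strategy; for odd n it labels an
  end vertex, so that a path of even length remains.\<close>

text \<open>\<open>resp A B Q s\<close>: with the opponent to move by \<open>A\<close>, the responder, who moves by \<open>B\<close> and may pass,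
  can force \<open>Q\<close> when the opponent is stuck.\<close>

inductive resp :: "('s \<Rightarrow> 's \<Rightarrow> bool) \<Rightarrow> ('s \<Rightarrow> 's \<Rightarrow> bool) \<Rightarrow> ('s \<Rightarrow> bool) \<Rightarrow> 's \<Rightarrow> bool"
  for A B Q where
  respI: "(\<And>s'. A s s' \<Longrightarrow> resp A B Q s' \<or> (\<exists>s''. B s' s'' \<and> resp A B Q s'')) \<Longrightarrow>
    ((\<And>s'. \<not> A s s') \<Longrightarrow> Q s) \<Longrightarrow> resp A B Q s"

lemma resp_step:
  assumes "resp A B Q s" "A s s'"
  shows "resp A B Q s' \<or> (\<exists>s''. B s' s'' \<and> resp A B Q s'')"
  using assms by (cases rule: resp.cases) auto

lemma resp_terminal: "resp A B Q s \<Longrightarrow> (\<And>s'. \<not> A s s') \<Longrightarrow> Q s"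
  by (cases rule: resp.cases) auto

text \<open>A simulation in two directions: moves of the opponent are copied into the game with a
  known strategy, and its replies are copied back. \<open>live\<close> excludes that the opponent is
  stuck in the new game while still able to move in the old one, where \<open>Q\<close> is promised
  only at the end.\<close>

lemma resp_transfer:
  assumes "resp A B Q t" and "R s t"
    and fwd: "\<And>s t s'. R s t \<Longrightarrow> A' s s' \<Longrightarrow> \<exists>t'. A t t' \<and> R s' t'"
    and bwd: "\<And>s t t'. R s t \<Longrightarrow> B t t' \<Longrightarrow> \<exists>s'. B' s s' \<and> R s' t'"
    and live: "\<And>s t t'. R s t \<Longrightarrow> A t t' \<Longrightarrow> \<exists>s'. A' s s'"
    and final: "\<And>s t. R s t \<Longrightarrow> (\<And>s'. \<not> A' s s') \<Longrightarrow> (\<And>t'. \<not> A t t') \<Longrightarrow> Q t \<Longrightarrow> Q' s"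
  shows "resp A' B' Q' s"
  using assms(1,2)
proof (induction arbitrary: s rule: resp.induct)
  case (respI t)
  show ?case
  proof (rule resp.respI)
    fix s' assume "A' s s'"
    then obtain t' where t': "A t t'" "R s' t'" using fwd respI.prems by blast
    from respI.IH(1)[OF t'(1)]
    show "resp A' B' Q' s' \<or> (\<exists>s''. B' s' s'' \<and> resp A' B' Q' s'')"
      using t'(2) bwd by metis
  next
    assume "\<And>s'. \<not> A' s s'"
    then show "Q' s" using final live respI.prems respI.hyps(1) by metis
  qed
qed

section \<open>The segment game\<close>

text \<open>A segment \<open>(k, a, b)\<close> is a run of \<open>k\<close> unlabelled vertices. The weights \<open>a\<close>, \<open>b\<close> describe what
  lies next to it: 2 for a vertex labelled 0, 0 for a vertex labelled 1, and 1 for an end of the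
  path. With these weights an exhausted segment \<open>(0, a, b)\<close> contributes exactly \<open>a * b\<close> to S.\<close>

type_synonym seg = "nat \<times> nat \<times> nat"

definition step :: "nat \<Rightarrow> seg multiset \<Rightarrow> seg multiset \<Rightarrow> bool" where
  "step w X Y \<longleftrightarrow> (\<exists>k a b i Z. X = add_mset (k, a, b) Z \<and> i < k \<and>
     Y = add_mset (i, a, w) (add_mset (k - 1 - i, w, b) Z))"

lemma stepI: "i < k \<Longrightarrow>
    step w (add_mset (k, a, b) Z) (add_mset (i, a, w) (add_mset (k - 1 - i, w, b) Z))"
  unfolding step_def by blast

lemma stepE:
  assumes "step w X Y"
  obtains k a b i Z where "X = add_mset (k, a, b) Z" "i < k"
    "Y = add_mset (i, a, w) (add_mset (k - 1 - i, w, b) Z)"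
  using assms unfolding step_def by blast

definition score :: "seg multiset \<Rightarrow> int" where
  "score X = (\<Sum>(k, a, b)\<in>#X. int (a * b))"

lemma score_simps [simp]: "score {#} = 0" "score (add_mset (k, a, b) X) = int a * int b + score X"
  "score (X + Y) = score X + score Y"
  by (simp_all add: score_def)

lemma no_step_iff: "(\<forall>Y. \<not> step w X Y) \<longleftrightarrow> (\<forall>s\<in>#X. fst s = 0)"
proof
  assume *: "\<forall>Y. \<not> step w X Y"
  show "\<forall>s\<in>#X. fst s = 0"
  proof (rule ccontr)
    assume "\<not> ?thesis"
    then obtain k a b where "(k, a, b) \<in># X" "k > 0" by auto
    then obtain Z where "X = add_mset (k, a, b) Z" by (metis multi_member_split)
    with stepI[OF \<open>k > 0\<close>] * show False by blast
  qed
next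
  assume "\<forall>s\<in>#X. fst s = 0"
  then show "\<forall>Y. \<not> step w X Y" by (auto elim!: stepE)
qed

text \<open>The opponent writes weight \<open>x\<close>, the responder weight \<open>y\<close>. Admirable responds with \<open>\<sigma> = 1\<close>,
  Impish with \<open>\<sigma> = - 1\<close>.\<close>

definition secures :: "nat \<Rightarrow> nat \<Rightarrow> int \<Rightarrow> seg multiset \<Rightarrow> int \<Rightarrow> bool" where
  "secures x y \<sigma> X c \<longleftrightarrow> resp (step x) (step y) (\<lambda>X. c \<le> \<sigma> * score X) X"

lemmas securesI = resp.respI[where A = "step x" and B = "step y" and Q = "\<lambda>X. c \<le> \<sigma> * score X"
    for x y \<sigma> c, folded secures_def]

lemmas secures_induct = resp.induct[where A = "step x" and B = "step y"
    and Q = "\<lambda>X. c \<le> \<sigma> * score X" for x y \<sigma> c, folded secures_def, consumes 1, case_names respI]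

lemmas secures_transfer = resp_transfer[where A = "step x" and B = "step y"
    and Q = "\<lambda>X. c \<le> \<sigma> * score X" and A' = "step x'" and B' = "step y'"
    and Q' = "\<lambda>X. c' \<le> \<sigma>' * score X" for x y \<sigma> c x' y' \<sigma>' c', folded secures_def]

lemma secures_mono: "secures x y \<sigma> X c \<Longrightarrow> d \<le> c \<Longrightarrow> secures x y \<sigma> X d"
  by (erule secures_transfer[where R = "(=)"]) auto

section \<open>Disjoint unions of positions\<close>

lemma step_union:
  assumes "step w (X + Y) Z"
  shows "(\<exists>X'. step w X X' \<and> Z = X' + Y) \<or> (\<exists>Y'. step w Y Y' \<and> Z = X + Y')"
proof -
  from assms obtain k a b i V where V: "X + Y = add_mset (k, a, b) V" "i < k"
    "Z = add_mset (i, a, w) (add_mset (k - 1 - i, w, b) V)" by (rule stepE)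
  then have "(k, a, b) \<in># X \<or> (k, a, b) \<in># Y" by (metis union_iff union_single_eq_member)
  then show ?thesis
  proof
    assume "(k, a, b) \<in># X"
    then obtain X0 where X0: "X = add_mset (k, a, b) X0" by (metis multi_member_split)
    with V have "V = X0 + Y" by simp
    with V(3) have "Z = add_mset (i, a, w) (add_mset (k - 1 - i, w, b) X0) + Y" by simp
    moreover have "step w X (add_mset (i, a, w) (add_mset (k - 1 - i, w, b) X0))"
      unfolding X0 by (rule stepI[OF V(2)])
    ultimately show ?thesis by blast
  next
    assume "(k, a, b) \<in># Y"
    then obtain Y0 where Y0: "Y = add_mset (k, a, b) Y0" by (metis multi_member_split)
    with V have "V = X + Y0" by simp
    with V(3) have "Z = X + add_mset (i, a, w) (add_mset (k - 1 - i, w, b) Y0)" by simp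
    moreover have "step w Y (add_mset (i, a, w) (add_mset (k - 1 - i, w, b) Y0))"
      unfolding Y0 by (rule stepI[OF V(2)])
    ultimately show ?thesis by blast
  qed
qed

lemma step_mono_left: "step w X X' \<Longrightarrow> step w (X + Y) (X' + Y)"
  by (erule stepE) (simp only: union_mset_add_mset_left stepI)

lemma step_mono_right: "step w Y Y' \<Longrightarrow> step w (X + Y) (X + Y')"
  using step_mono_left[of w Y Y' X] by (simp add: add.commute)

text \<open>A move of the opponent is answered, or passed, by the strategy of the component that it
  hits. A move in one component leaves the other as it was, so the induction is nested: over
  \<open>X\<close> for all \<open>Y\<close>, then over \<open>Y\<close> for fixed
  \<open>X\<close>.\<close>

lemma secures_union:
  assumes "secures x y \<sigma> X c" "secures x y \<sigma> Y d"
  shows "secures x y \<sigma> (X + Y) (c + d)"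
  using assms
proof (induction arbitrary: Y rule: secures_induct)
  case (respI X)
  note outer = respI.IH and X = respI.hyps
  from respI.prems show ?case
  proof (induction rule: secures_induct)
    case (respI Y)
    have Y: "secures x y \<sigma> Y d"
      by (rule securesI) (use respI in blast)+
    show ?case
    proof (rule securesI)
      fix Z assume "step x (X + Y) Z"
      from step_union[OF this]
      show "secures x y \<sigma> Z (c + d) \<or> (\<exists>Z'. step y Z Z' \<and> secures x y \<sigma> Z' (c + d))"
      proof (elim disjE exE conjE)
        fix X' assume X': "step x X X'" "Z = X' + Y"
        from outer[OF X'(1)] show ?thesis
          unfolding X'(2) using Y step_mono_left by blast
      next
        fix Y' assume Y': "step x Y Y'" "Z = X + Y'"
        from respI.IH[OF Y'(1)] show ?thesis
          unfolding Y'(2) using step_mono_right by blast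
      qed
    next
      assume stuck: "\<And>Z. \<not> step x (X + Y) Z"
      have "c \<le> \<sigma> * score X"
        by (rule X) (use stuck step_mono_left in blast)
      moreover have "d \<le> \<sigma> * score Y"
        by (rule respI.hyps) (use stuck step_mono_right in blast)
      ultimately show "c + d \<le> \<sigma> * score (X + Y)" by (simp add: algebra_simps)
    qed
  qed
qed

section \<open>Segments up to reflection\<close>

definition norm_seg :: "seg \<Rightarrow> seg" where
  "norm_seg = (\<lambda>(k, a, b). (k, min a b, max a b))"

lemma score_norm: "score (image_mset norm_seg X) = score X"
proof (induction X)
  case (add s X)
  then show ?case by (cases s) (auto simp: norm_seg_def min_def max_def)
qed simp

lemma norm_seg_eqD: "norm_seg s = norm_seg (k, a, b) \<Longrightarrow> s = (k, a, b) \<or> s = (k, b, a)"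
  by (cases s) (auto simp: norm_seg_def min_def max_def split: if_splits)

lemma norm_seg_swap: "norm_seg (k, b, a) = norm_seg (k, a, b)"
  by (auto simp: norm_seg_def min.commute max.commute)

lemma image_mset_add_eqD:
  assumes "image_mset f X = add_mset y Z"
  obtains s V where "X = add_mset s V" "f s = y" "image_mset f V = Z"
  using assms by (metis msed_map_invR)

lemma step_norm:
  assumes "image_mset norm_seg X = image_mset norm_seg X'" "step w X Y"
  shows "\<exists>Y'. step w X' Y' \<and> image_mset norm_seg Y = image_mset norm_seg Y'"
proof -
  from assms(2) obtain k a b i Z where Z: "X = add_mset (k, a, b) Z" "i < k"
    "Y = add_mset (i, a, w) (add_mset (k - 1 - i, w, b) Z)" by (rule stepE)
  have "image_mset norm_seg X' = add_mset (norm_seg (k, a, b)) (image_mset norm_seg Z)"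
    using assms(1) Z(1) by simp
  then obtain s V where V: "X' = add_mset s V" "norm_seg s = norm_seg (k, a, b)"
    "image_mset norm_seg V = image_mset norm_seg Z" by (rule image_mset_add_eqD)
  from norm_seg_eqD[OF V(2)] show ?thesis
  proof
    assume "s = (k, a, b)"
    then have "step w X' (add_mset (i, a, w) (add_mset (k - 1 - i, w, b) V))"
      unfolding V(1) using stepI[OF Z(2)] by simp
    then show ?thesis using V(3) Z(3) by (intro exI conjI) auto
  next
    assume s: "s = (k, b, a)"
    \<comment> \<open>Cell \<open>i\<close> of a segment is cell \<open>k - 1 - i\<close> of its
      mirror image.\<close>
    have *: "k - 1 - i < k" "k - 1 - (k - 1 - i) = i" using Z(2) by auto
    have "step w X' (add_mset (k - 1 - i, b, w) (add_mset (i, w, a) V))"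
      unfolding V(1) s using stepI[OF *(1), of w b a V] unfolding *(2) .
    then show ?thesis using V(3) Z(3)
      by (intro exI conjI) (auto simp: norm_seg_swap[of _ w a] norm_seg_swap[of _ b w] add_mset_commute)
  qed
qed

text \<open>The tables store every segment with the smaller weight first; this carries their claims
  over to the position actually reached.\<close>

lemma secures_norm:
  assumes "secures x y \<sigma> X c" "image_mset norm_seg X = image_mset norm_seg Y"
  shows "secures x y \<sigma> Y c"
proof (rule secures_transfer[OF assms(1), where R = "\<lambda>Y X. image_mset norm_seg X = image_mset norm_seg Y"])
  show "image_mset norm_seg X = image_mset norm_seg Y" by fact
next
  fix Y X Y' assume "image_mset norm_seg X = image_mset norm_seg Y" "step x Y Y'"
  from step_norm[OF this(1)[symmetric] this(2)]
  show "\<exists>X'. step x X X' \<and> image_mset norm_seg X' = image_mset norm_seg Y'" by metis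
next
  fix Y X X' assume "image_mset norm_seg X = image_mset norm_seg Y" "step y X X'"
  from step_norm[OF this]
  show "\<exists>Y'. step y Y Y' \<and> image_mset norm_seg X' = image_mset norm_seg Y'" .
next
  fix Y X X' assume "image_mset norm_seg X = image_mset norm_seg Y" "step x X X'"
  from step_norm[OF this] show "\<exists>Y'. step x Y Y'" by blast
next
  fix Y X :: "seg multiset"
  assume "image_mset norm_seg X = image_mset norm_seg Y" "c \<le> \<sigma> * score X"
  then show "c \<le> \<sigma> * score Y" by (metis score_norm)
qed

lemma secures_leaf:
  assumes "\<forall>s\<in>#X. fst s = 0"
  shows "secures x y \<sigma> X (\<sigma> * score X)"
  using assms no_step_iff[of x X] by (intro securesI) auto

text \<open>Passing throughout suffices, as all weights are nonnegative. A step trades one segment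
  for two but uses up a cell, so with cells counted twice the measure drops by one.\<close>

lemma secures_nonneg: "secures x y 1 X 0"
proof (induction "size X + sum_mset (image_mset (\<lambda>s. 2 * fst s) X)" arbitrary: X rule: less_induct)
  case less
  show ?case
  proof (rule securesI)
    fix Y assume "step x X Y"
    then have "secures x y 1 Y 0"
      by (intro less) (auto elim!: stepE)
    then show "secures x y 1 Y 0 \<or> (\<exists>Z. step y Y Z \<and> secures x y 1 Z 0)" ..
  next
    show "0 \<le> 1 * score X" by (induction X) (auto simp: score_def)
  qed
qed

lemma step_add_mset_cases:
  assumes "step w (add_mset (k, a, b) X) Y"
  obtains (here) i where "i < k" "Y = add_mset (i, a, w) (add_mset (k - 1 - i, w, b) X)"
    | (there) X' where "step w X X'" "Y = add_mset (k, a, b) X'"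
proof -
  from step_union[of w "{#(k, a, b)#}" X Y] assms consider
    X' where "step w {#(k, a, b)#} X'" "Y = X' + X" | X' where "step w X X'" "Y = {#(k, a, b)#} + X'"
    by auto
  then show thesis
  proof cases
    case 1
    then show thesis by (auto elim!: stepE intro: here)
  next
    case 2
    then show thesis by (auto intro: there)
  qed
qed

lemma step_add_mset: "step w X X' \<Longrightarrow> step w (add_mset s X) (add_mset s X')"
  using step_mono_right[of w X X' "{#s#}"] by simp

section \<open>Cutting a segment and joining it again\<close>

definition joined :: "seg multiset \<Rightarrow> seg multiset \<Rightarrow> bool" where
  "joined Z Y \<longleftrightarrow> (\<exists>k l a b X. Z = add_mset (k + l, a, b) X \<and>
     Y = add_mset (k, a, 1) (add_mset (l, 1, b) X) \<and> a \<le> 2 \<and> b \<le> 2)"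

lemma joinedI: "a \<le> 2 \<Longrightarrow> b \<le> 2 \<Longrightarrow> m = k + l \<Longrightarrow> Z = add_mset (m, a, b) X \<Longrightarrow>
    Y = add_mset (k, a, 1) (add_mset (l, 1, b) X) \<Longrightarrow> joined Z Y"
  unfolding joined_def by blast

text \<open>A cut removes no cell, so the cells of both positions correspond, and a new label leaves
  the cut inside one of the two pieces that it creates. The bounds on the weights travel along in
  \<open>joined\<close> because the final comparison of scores needs them.\<close>

lemma joined_forward:
  assumes "joined Z Y" "step w Z Z'" "w \<le> 2"
  shows "\<exists>Y'. step w Y Y' \<and> joined Z' Y'"
proof -
  from assms(1) obtain k l a b X where
    Z: "Z = add_mset (k + l, a, b) X" and
    Y: "Y = add_mset (k, a, 1) (add_mset (l, 1, b) X)" and ab: "a \<le> 2" "b \<le> 2"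
    unfolding joined_def by blast
  from assms(2)[unfolded Z] show ?thesis
  proof (cases rule: step_add_mset_cases)
    case (here i)
    show ?thesis
    proof (cases "i < k")
      case True
      let ?Y = "add_mset (i, a, w) (add_mset (k - 1 - i, w, 1) (add_mset (l, 1, b) X))"
      have "step w Y ?Y" unfolding Y by (rule stepI[OF True])
      moreover have "joined Z' ?Y"
        by (rule joinedI[of w b _ "k - 1 - i" l _ "add_mset (i, a, w) X"])
          (use assms(3) ab True here in \<open>auto simp: add_mset_commute\<close>)
      ultimately show ?thesis by blast
    next
      case False
      define j where "j = i - k"
      have j: "j < l" "i = k + j" using False here(1) by (auto simp: j_def)
      let ?Y = "add_mset (k, a, 1) (add_mset (j, 1, w) (add_mset (l - 1 - j, w, b) X))"
      have "step w Y ?Y" unfolding Y by (intro step_add_mset stepI j)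
      moreover have "joined Z' ?Y"
        by (rule joinedI[of a w _ k j _ "add_mset (l - 1 - j, w, b) X"])
          (use assms(3) ab j here in \<open>auto simp: add_mset_commute\<close>)
      ultimately show ?thesis by blast
    qed
  next
    case (there X')
    then show ?thesis using ab unfolding Y by (blast intro: step_add_mset joinedI)
  qed
qed

lemma joined_backward:
  assumes "joined Z Y" "step w Y Y'" "w \<le> 2"
  shows "\<exists>Z'. step w Z Z' \<and> joined Z' Y'"
proof -
  from assms(1) obtain k l a b X where
    Z: "Z = add_mset (k + l, a, b) X" and
    Y: "Y = add_mset (k, a, 1) (add_mset (l, 1, b) X)" and ab: "a \<le> 2" "b \<le> 2"
    unfolding joined_def by blast
  from assms(2)[unfolded Y] show ?thesis
  proof (cases rule: step_add_mset_cases)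
    case (here i)
    let ?Z = "add_mset (i, a, w) (add_mset (k + l - 1 - i, w, b) X)"
    have "step w Z ?Z" unfolding Z by (rule stepI) (use here(1) in simp)
    moreover have "joined ?Z Y'"
      by (rule joinedI[of w b _ "k - 1 - i" l _ "add_mset (i, a, w) X"])
        (use assms(3) ab here in \<open>auto simp: add_mset_commute\<close>)
    ultimately show ?thesis by blast
  next
    case (there X')
    from there(1) show ?thesis
    proof (cases rule: step_add_mset_cases)
      case (here j)
      let ?Z = "add_mset (k + j, a, w) (add_mset (k + l - 1 - (k + j), w, b) X)"
      have "step w Z ?Z" unfolding Z by (rule stepI) (use here(1) in simp)
      moreover have "joined ?Z Y'"
        by (rule joinedI[of a w _ k j _ "add_mset (l - 1 - j, w, b) X"])
          (use assms(3) ab here there(2) in \<open>auto simp: add_mset_commute\<close>)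
      ultimately show ?thesis by blast
    next
      case there': (there X'')
      then show ?thesis using ab there(2) unfolding Z by (blast intro: step_add_mset joinedI)
    qed
  qed
qed

text \<open>At the end the two pieces at the cut contribute a + b in place of a * b. The difference
  a * b - (a + b) equals (a - 1) * (b - 1) - 1, which lies between -2 and 0 for weights up to 2;
  this gives both alternatives for \<open>d\<close>.\<close>

lemma secures_join:
  assumes "secures x y \<sigma> (add_mset (k, a, 1) (add_mset (l, 1, b) X)) c"
    and xy: "x \<le> 2" "y \<le> 2" and ab: "a \<le> 2" "b \<le> 2"
    and \<sigma>: "\<sigma> = 1 \<and> d = c - 2 \<or> \<sigma> = - 1 \<and> d = c"
  shows "secures x y \<sigma> (add_mset (k + l, a, b) X) d"
  using assms(1)
proof (rule secures_transfer[where R = joined])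
  show "joined (add_mset (k + l, a, b) X) (add_mset (k, a, 1) (add_mset (l, 1, b) X))"
    using ab by (blast intro: joinedI)
next
  fix Z Y Z' assume "joined Z Y" "step x Z Z'"
  then show "\<exists>Y'. step x Y Y' \<and> joined Z' Y'" using xy by (rule_tac joined_forward)
next
  fix Z Y Y' assume "joined Z Y" "step y Y Y'"
  then show "\<exists>Z'. step y Z Z' \<and> joined Z' Y'" using xy by (rule_tac joined_backward)
next
  fix Z Y Y' assume "joined Z Y" "step x Y Y'"
  then show "\<exists>Z'. step x Z Z'" using joined_backward[of Z Y x Y'] xy by blast
next
  fix Z Y assume "joined Z Y" and stuck: "\<And>Y'. \<not> step x Y Y'" and c: "c \<le> \<sigma> * score Y"
  then obtain k l a b X where
    Z: "Z = add_mset (k + l, a, b) X" and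
    Y: "Y = add_mset (k, a, 1) (add_mset (l, 1, b) X)" and ab: "a \<le> 2" "b \<le> 2"
    unfolding joined_def by blast
  have "a = 0 \<or> a = 1 \<or> a = 2" "b = 0 \<or> b = 1 \<or> b = 2" using ab by auto
  then show "d \<le> \<sigma> * score Z" using \<sigma> c unfolding Z Y by auto
qed

section \<open>Checking tables of positions\<close>

definition place :: "nat \<Rightarrow> seg \<Rightarrow> nat \<Rightarrow> seg list" where
  "place w s i = (case s of (k, a, b) \<Rightarrow> [norm_seg (i, a, w), norm_seg (k - 1 - i, w, b)])"

text \<open>The two pieces of the segment just hit are put first. In a hint the indices 0 and 1 thus
  denote these pieces and higher indices the untouched segments; \<open>us\<close> holds the
  segments already passed over, latest first.\<close>

fun moves :: "nat \<Rightarrow> seg list \<Rightarrow> seg list \<Rightarrow> seg list list" where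
  "moves w us [] = []"
| "moves w us (s # ss) = map (\<lambda>i. place w s i @ us @ ss) [0..<fst s] @ moves w (s # us) ss"

text \<open>An index out of range counts as a pass. Every hint is thus a legal answer, and soundness
  of the check demands nothing of the hints.\<close>

fun reply :: "nat \<Rightarrow> seg list \<Rightarrow> (nat \<times> nat) option \<Rightarrow> seg list" where
  "reply w ss None = ss"
| "reply w ss (Some (j, i)) =
     (case drop j ss of [] \<Rightarrow> ss
      | s # us \<Rightarrow> if i < fst s then place w s i @ take j ss @ us else ss)"

type_synonym bound = "seg list \<times> int"

text \<open>Out of range indices yield the trivial claim about the empty position.\<close>

fun nth_bound :: "bound list \<Rightarrow> nat \<Rightarrow> bound" where
  "nth_bound [] n = ([], 0)"
| "nth_bound (e # es) 0 = e"
| "nth_bound (e # es) (Suc n) = nth_bound es n"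

definition leaf_score :: "seg list \<Rightarrow> int" where
  "leaf_score ss = sum_list (map (\<lambda>(k, a, b). if k = 0 then int (a * b) else 0) ss)"

definition bounded_by :: "int \<Rightarrow> bound list \<Rightarrow> seg list \<Rightarrow> int \<Rightarrow> nat list \<Rightarrow> bool" where
  "bounded_by \<sigma> T ss c is =
     (let us = filter (\<lambda>(k, a, b). k \<noteq> 0) ss; es = map (nth_bound T) is; vs = concat (map fst es)
      in c \<le> \<sigma> * leaf_score ss + sum_list (map snd es) \<and>
         (if \<sigma> = 1 then mset vs \<subseteq># mset us else mset vs = mset us))"

text \<open>An entry \<open>(ss, c, hs)\<close> claims that the responder secures \<open>c\<close> at \<open>ss\<close>. The list \<open>hs\<close> has one hint
  per opponent move, in the order of \<open>moves\<close>: the reply (segment index and cell, or \<open>None\<close> for a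
  pass) and the indices of the table entries into which the resulting position decomposes.
  Admirable may leave segments uncovered, as they cannot lower S.\<close>

type_synonym cert = "seg list \<times> int \<times> ((nat \<times> nat) option \<times> nat list) list"

definition bounds :: "cert list \<Rightarrow> bound list" where
  "bounds = map (\<lambda>(ss, c, hs). (ss, c))"

definition check_entry :: "nat \<Rightarrow> nat \<Rightarrow> int \<Rightarrow> bound list \<Rightarrow> cert \<Rightarrow> bool" where
  "check_entry x y \<sigma> T = (\<lambda>(ss, c, hs). hs \<noteq> [] \<and>
     list_all2 (\<lambda>us (r, is). bounded_by \<sigma> T (reply y us r) c is) (moves x [] ss) hs)"

definition free_count :: "seg multiset \<Rightarrow> nat" where
  "free_count X = sum_mset (image_mset fst X)"

lemma free_count_simps [simp]: "free_count {#} = 0" "free_count (add_mset s X) = fst s + free_count X"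
  "free_count (X + Y) = free_count X + free_count Y"
  by (simp_all add: free_count_def)

lemma free_count_step: "step w X Y \<Longrightarrow> Suc (free_count Y) = free_count X"
  by (auto elim!: stepE)

lemma fst_norm_seg [simp]: "fst (norm_seg s) = fst s"
  by (cases s) (simp add: norm_seg_def)

lemma free_count_norm: "free_count (image_mset norm_seg X) = free_count X"
  by (induction X) auto

lemma free_count_mono: "X \<subseteq># Y \<Longrightarrow> free_count X \<le> free_count Y"
  by (auto simp: free_count_def dest!: mset_subset_eq_exists_conv[THEN iffD1])

lemma norm_seg_idem [simp]: "norm_seg (norm_seg s) = norm_seg s"
  by (cases s) (auto simp: norm_seg_def min_def max_def)

lemma image_mset_norm_place:
  "image_mset norm_seg (mset (place w (k, a, b) i)) =
     {#norm_seg (i, a, w), norm_seg (k - 1 - i, w, b)#}"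
  by (simp add: place_def)

lemma moves_complete:
  assumes "step w (mset ss) Y"
  shows "\<exists>us\<in>set (moves w vs ss). image_mset norm_seg (mset us) = image_mset norm_seg (mset vs + Y)"
  using assms
proof (induction ss arbitrary: vs Y)
  case Nil
  then show ?case by (auto elim!: stepE)
next
  case (Cons s ss)
  obtain k a b where s: "s = (k, a, b)" by (cases s)
  from Cons.prems have "step w (add_mset (k, a, b) (mset ss)) Y" by (simp add: s)
  then show ?case
  proof (cases rule: step_add_mset_cases)
    case (here i)
    then show ?thesis
      by (intro bexI[of _ "place w s i @ vs @ ss"]) (auto simp: s image_mset_norm_place)
  next
    case (there X')
    from Cons.IH[OF there(1), of "s # vs"] show ?thesis
      by (auto simp: there(2) s)
  qed
qed

lemma reply_step:
  assumes "image_mset norm_seg (mset ss) = image_mset norm_seg X"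
  shows "\<exists>Y. (Y = X \<or> step w X Y) \<and> image_mset norm_seg (mset (reply w ss r)) = image_mset norm_seg Y"
proof (cases "reply w ss r = ss")
  case False
  then obtain j i where r: "r = Some (j, i)" by (cases r) auto
  with False obtain s us where us: "drop j ss = s # us" "i < fst s"
    "reply w ss r = place w s i @ take j ss @ us"
    by (auto split: list.splits if_splits)
  obtain k a b where s: "s = (k, a, b)" by (cases s)
  have "ss = take j ss @ s # us" by (metis us(1) append_take_drop_id)
  then have "mset ss = add_mset (k, a, b) (mset (take j ss) + mset us)"
    by (metis s mset.simps(2) mset_append union_mset_add_mset_right)
  then have "step w (mset ss) (add_mset (i, a, w) (add_mset (k - 1 - i, w, b) (mset (take j ss) + mset us)))"
    (is "step _ _ ?Y") using us(2) s by (simp only: fst_conv stepI)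
  from step_norm[OF assms this] obtain Y where
    "step w X Y" "image_mset norm_seg ?Y = image_mset norm_seg Y" by blast
  then show ?thesis unfolding us(3) by (intro exI[of _ Y]) (auto simp: s image_mset_norm_place)
qed (use assms in auto)

lemma leaf_score: "leaf_score ss = score (mset (filter (\<lambda>s. fst s = 0) ss))"
  by (induction ss) (auto simp: leaf_score_def)

lemma secures_bounds_sum:
  assumes "\<And>i. i \<in> set is \<Longrightarrow> secures x y \<sigma> (mset (fst (nth_bound T i))) (snd (nth_bound T i))"
  shows "secures x y \<sigma> (mset (concat (map (fst \<circ> nth_bound T) is))) (sum_list (map (snd \<circ> nth_bound T) is))"
  using assms
proof (induction "is")
  case Nil
  show ?case using secures_leaf[of "{#}" x y \<sigma>] by simp
next
  case (Cons i "is")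
  then show ?case
    by (simp add: secures_union)
qed

lemma nth_bound_in: "nth_bound T i \<in> set T \<or> nth_bound T i = ([], 0)"
  by (induction T i rule: nth_bound.induct) auto

text \<open>The position splits into exhausted segments, segments covered by table entries, and the
  rest, and guarantees of disjoint parts add up. The rest is worth at least 0 to Admirable and is
  empty for Impish. The table is trusted only for positions with no more free cells than
  \<open>ss\<close>, which is what an induction on free cells can supply.\<close>

lemma bounded_by_secures:
  assumes "bounded_by \<sigma> T ss c is" "\<sigma> = 1 \<or> \<sigma> = - 1"
    and T: "\<And>us d. (us, d) \<in> set T \<Longrightarrow> free_count (mset us) \<le> free_count (mset ss) \<Longrightarrow> secures x y \<sigma> (mset us) d"
  shows "secures x y \<sigma> (mset ss) c"
proof -
  let ?live = "mset (filter (\<lambda>s. fst s \<noteq> 0) ss)" and ?dead = "mset (filter (\<lambda>s. fst s = 0) ss)"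
  let ?used = "mset (concat (map (fst \<circ> nth_bound T) is))"
  have *: "c \<le> \<sigma> * leaf_score ss + sum_list (map (snd \<circ> nth_bound T) is)"
    and sub: "?used \<subseteq># ?live" and eq: "\<sigma> = - 1 \<Longrightarrow> ?used = ?live"
    using assms(1,2) by (auto simp: bounded_by_def Let_def case_prod_unfold comp_def split: if_splits)
  have split: "mset ss = ?dead + (?used + (?live - ?used))"
    using sub multiset_partition[of "mset ss" "\<lambda>s. fst s = 0"] by simp
  have used: "secures x y \<sigma> ?used (sum_list (map (snd \<circ> nth_bound T) is))"
  proof (rule secures_bounds_sum)
    fix i assume i: "i \<in> set is"
    from nth_bound_in[of T i]
    show "secures x y \<sigma> (mset (fst (nth_bound T i))) (snd (nth_bound T i))"
    proof
      assume *: "nth_bound T i \<in> set T"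
      have "mset (fst (nth_bound T i)) \<subseteq># ?used"
        using split_list[OF i] by auto
      then have "free_count (mset (fst (nth_bound T i))) \<le> free_count ?used" by (rule free_count_mono)
      also have "\<dots> \<le> free_count (mset ss)"
        unfolding arg_cong[OF split, of free_count] free_count_simps by simp
      finally show ?thesis using T[of "fst (nth_bound T i)" "snd (nth_bound T i)"] * by simp
    next
      assume "nth_bound T i = ([], 0)"
      then show ?thesis using secures_leaf[of "{#}" x y \<sigma>] by simp
    qed
  qed
  have rest: "secures x y \<sigma> (?live - ?used) 0"
    using assms(2)
  proof
    assume "\<sigma> = 1"
    then show ?thesis using secures_nonneg by simp
  next
    assume "\<sigma> = - 1"
    then show ?thesis using eq secures_leaf[of "{#}" x y \<sigma>] by simp
  qed
  have "secures x y \<sigma> ?dead (\<sigma> * leaf_score ss)"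
    unfolding leaf_score by (rule secures_leaf) auto
  from secures_union[OF this secures_union[OF used rest]] show ?thesis
    unfolding split[symmetric] by (rule secures_mono) (use * in simp)
qed

text \<open>Entries may refer to each other in any order: a covering entry consists of live segments
  left after a move of the opponent, so it has fewer free cells than the entry under check.
  Induction on free cells thus excludes circular reasoning.\<close>

theorem check_sound:
  assumes "list_all (check_entry x y \<sigma> (bounds C)) C" "\<sigma> = 1 \<or> \<sigma> = - 1"
    and "(ss, c) \<in> set (bounds C)"
  shows "secures x y \<sigma> (mset ss) c"
  using assms(3)
proof (induction "free_count (mset ss)" arbitrary: ss c rule: less_induct)
  case less
  then obtain hs where hs: "(ss, c, hs) \<in> set C" by (auto simp: bounds_def)
  with assms(1) have "hs \<noteq> []" and all2:
    "list_all2 (\<lambda>us (r, is). bounded_by \<sigma> (bounds C) (reply y us r) c is) (moves x [] ss) hs"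
    by (auto simp: list_all_iff check_entry_def)
  show ?case
  proof (rule securesI)
    fix Y assume step: "step x (mset ss) Y"
    from moves_complete[OF this, of "[]"] obtain us where
      us: "us \<in> set (moves x [] ss)" "image_mset norm_seg (mset us) = image_mset norm_seg Y"
      by auto
    from all2 us(1) obtain r "is" where
      ri: "bounded_by \<sigma> (bounds C) (reply y us r) c is"
      by (fastforce simp: list_all2_conv_all_nth in_set_conv_nth)
    from reply_step[OF us(2), of y r] obtain Z where
      Z: "Z = Y \<or> step y Y Z" "image_mset norm_seg (mset (reply y us r)) = image_mset norm_seg Z"
      by blast
    have "free_count (mset (reply y us r)) = free_count Z" using Z(2) by (metis free_count_norm)
    also have "\<dots> < free_count (mset ss)" using Z(1) free_count_step[OF step] free_count_step[of y Y Z] by auto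
    finally have "secures x y \<sigma> (mset (reply y us r)) c"
      using less.hyps by (intro bounded_by_secures[OF ri assms(2)]) auto
    from secures_norm[OF this Z(2)]
    show "secures x y \<sigma> Y c \<or> (\<exists>Z. step y Y Z \<and> secures x y \<sigma> Z c)" using Z(1) by blast
  next
    \<comment> \<open>A checked entry has a hint for some move, so its position is never terminal.
      Exhausted segments are evaluated by \<open>leaf_score\<close> when they arise.\<close>
    assume stuck: "\<And>Y. \<not> step x (mset ss) Y"
    from \<open>hs \<noteq> []\<close> all2 have "moves x [] ss \<noteq> []" by auto
    moreover have "moves x vs us = []" if "\<forall>s\<in>set us. fst s = 0" for vs us
      using that by (induction us arbitrary: vs) auto
    ultimately have False using stuck no_step_iff[of x "mset ss"] by auto
    then show "c \<le> \<sigma> * score (mset ss)" ..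
  qed
qed

section \<open>Short paths\<close>

text \<open>Both tables were found by computer search.\<close>

definition maker_table :: "cert list" where
  "maker_table = [
  ([(1, 0, 1), (1, 0, 1)], 2, [(Some (2, 0), []), (Some (2, 0), [])]),
  ([(1, 0, 1), (1, 0, 2)], 2, [(Some (2, 0), []), (Some (2, 0), [])]),
  ([(1, 0, 1), (1, 1, 2)], 2, [(Some (2, 0), []), (Some (2, 0), [])]),
  ([(1, 0, 2), (1, 0, 2)], 4, [(Some (2, 0), []), (Some (2, 0), [])]),
  ([(1, 0, 2), (1, 1, 2)], 4, [(Some (2, 0), []), (Some (2, 0), [])]),
  ([(1, 1, 2), (1, 1, 2)], 6, [(Some (2, 0), []), (Some (2, 0), [])]),
  ([(1, 1, 2), (1, 2, 2)], 6, [(Some (2, 0), []), (Some (2, 0), [])]),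
  ([(2, 1, 1)], 2, [(Some (1, 0), []), (Some (0, 0), [])]),
  ([(2, 1, 2)], 2, [(Some (1, 0), []), (Some (0, 0), [])]),
  ([(1, 0, 1), (2, 0, 2)], 2, [(Some (2, 1), []), (None, [1]), (Some (2, 0), [])]),
  ([(1, 0, 2), (2, 0, 1)], 2, [(Some (2, 1), []), (None, [1]), (Some (2, 0), [])]),
  ([(1, 0, 2), (2, 0, 2)], 4, [(Some (2, 1), []), (None, [3]), (Some (2, 0), [])]),
  ([(1, 0, 2), (2, 1, 2)], 4, [(Some (2, 1), []), (None, [3]), (Some (2, 0), [])]),
  ([(1, 1, 2), (2, 0, 2)], 4, [(Some (2, 1), []), (None, [4]), (Some (2, 0), [])]),
  ([(1, 0, 1), (1, 0, 2), (2, 1, 2)], 6, [(Some (2, 0), [8]), (Some (3, 1), [2]), (Some (1, 0),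
     [1]), (Some (2, 0), [0])]),
  ([(1, 0, 2), (1, 1, 2), (2, 0, 1)], 6, [(Some (2, 0), []), (Some (3, 1), [3]), (Some (1, 0),
     [4]), (Some (2, 0), [])]),
  ([(1, 0, 2), (3, 0, 1)], 4, [(Some (2, 1), [4]), (Some (1, 0), [4]), (Some (2, 0), []), (Some
     (0, 0), [3])]),
  ([(1, 0, 2), (3, 0, 2)], 4, [(Some (2, 2), []), (None, [11]), (None, [3]), (Some (0, 0), [3])]),
  ([(1, 1, 2), (3, 0, 0)], 4, [(Some (2, 1), [3]), (Some (1, 0), [4]), (Some (2, 0), []), (Some
     (0, 0), [4])]),
  ([(1, 1, 2), (3, 0, 2)], 4, [(Some (2, 2), []), (None, [13]), (None, [4]), (Some (0, 0), [4])]),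
  ([(4, 0, 1)], 2, [(Some (1, 0), [8]), (Some (1, 1), []), (Some (0, 0), [1]), (Some (0, 1),
     [3])]),
  ([(4, 0, 2)], 4, [(Some (1, 2), []), (Some (1, 1), []), (Some (0, 0), [3]), (Some (0, 1),
     [3])]),
  ([(4, 1, 1)], 4, [(Some (1, 1), [4]), (Some (1, 1), [1]), (Some (0, 1), [1]), (Some (0, 1),
     [4])]),
  ([(1, 0, 1), (2, 0, 2), (2, 0, 2)], 6, [(Some (2, 1), [11]), (Some (1, 0), [9]), (Some (3, 1),
     [1]), (Some (1, 0), [9]), (Some (2, 1), [1])]),
  ([(1, 0, 2), (2, 0, 2), (2, 0, 2)], 8, [(Some (2, 1), [11]), (Some (1, 0), [11]), (Some (3, 1),
     [3]), (Some (1, 0), [11]), (Some (2, 1), [3])]),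
  ([(1, 0, 2), (2, 0, 2), (2, 1, 2)], 8, [(Some (2, 1), [12]), (Some (1, 0), [12]), (Some (3, 1),
     [4]), (Some (1, 0), [11]), (Some (2, 1), [3])]),
  ([(1, 0, 2), (4, 0, 0)], 4, [(Some (2, 1), [11]), (Some (1, 0), [11]), (Some (1, 0), [3]), (Some
     (0, 0), [3]), (Some (0, 0), [11])]),
  ([(1, 0, 2), (4, 0, 1)], 4, [(Some (2, 1), [12]), (None, [16]), (Some (1, 0), [4]), (Some (0,
     0), [3]), (Some (0, 0), [11])]),
  ([(1, 1, 2), (2, 0, 2), (2, 0, 2)], 8, [(Some (2, 1), [11]), (Some (1, 0), [13]), (Some (3, 1),
     [4]), (Some (1, 0), [13]), (Some (2, 1), [4])]),
  ([(2, 0, 2), (3, 0, 0)], 4, [(Some (1, 0), []), (Some (2, 1), [3]), (Some (1, 0), [11]), (Some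
     (2, 1), []), (Some (0, 0), [11])]),
  ([(2, 0, 2), (3, 0, 1)], 4, [(None, [16]), (Some (2, 1), [4]), (Some (1, 0), [13]), (Some (2,
     1), []), (Some (0, 0), [11])]),
  ([(2, 0, 2), (3, 0, 2)], 4, [(None, [17]), (Some (2, 2), []), (Some (1, 1), []), (None, [11]),
     (Some (0, 0), [11])]),
  ([(5, 0, 2)], 4, [(None, [21]), (Some (1, 2), []), (Some (0, 0), [11]), (Some (0, 0), [11]),
     (Some (0, 1), [11])]),
  ([(1, 0, 2), (5, 0, 0)], 4, [(Some (2, 0), [21]), (None, [26]), (Some (1, 0), [11]), (Some (0,
     0), [3]), (Some (0, 0), [11]), (None, [26])]),
  ([(1, 1, 2), (5, 0, 1)], 6, [(Some (2, 4), [21]), (Some (1, 1), [4, 8]), (Some (1, 1), [5]),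
     (Some (0, 0), [15]), (Some (0, 1), [1, 4]), (Some (2, 0), [])]),
  ([(2, 0, 2), (2, 0, 2), (2, 1, 2)], 8, [(None, [25]), (Some (2, 1), [12]), (None, [25]), (Some
     (2, 1), [12]), (None, [24]), (Some (2, 1), [11])]),
  ([(2, 0, 2), (4, 0, 0)], 4, [(None, [26]), (Some (2, 1), [11]), (None, [29]), (Some (1, 0),
     [11]), (Some (0, 0), [11]), (None, [29])]),
  ([(3, 0, 0), (3, 0, 2)], 4, [(Some (1, 0), [17]), (Some (2, 2), []), (Some (0, 0), [17]), (None,
     [29]), (Some (1, 0), []), (Some (2, 1), [3])]),
  ([(6, 0, 0)], 4, [(Some (1, 0), [21]), (Some (1, 1), [11]), (Some (1, 1), [3]), (Some (0, 1),
     [3]), (Some (0, 1), [11]), (Some (0, 0), [21])]),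
  ([(6, 0, 2)], 4, [(None, [32]), (None, [21]), (Some (0, 0), [17]), (None, [29]), (None, [26]),
     (Some (0, 0), [21])]),
  ([(6, 1, 1)], 6, [(Some (1, 4), [21]), (Some (1, 1), [14]), (Some (0, 1), [16]), (Some (0, 1),
     [15]), (Some (0, 1), [14]), (Some (0, 4), [21])]),
  ([(6, 1, 2)], 6, [(Some (1, 4), [21]), (Some (0, 0), [21]), (Some (0, 1), [17]), (Some (1, 1),
     [16]), (Some (0, 1), [3, 8]), (Some (0, 4), [21])]),
  ([(6, 2, 2)], 8, [(Some (1, 4), [21]), (Some (0, 0), [21]), (Some (0, 1), [17]), (Some (1, 1),
     [17]), (Some (0, 3), [17]), (Some (0, 4), [21])]),
  ([(1, 0, 1), (6, 0, 2)], 6, [(Some (2, 5), [32]), (Some (1, 4), [21]), (Some (2, 0), [21]),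
     (Some (1, 2), [9]), (Some (0, 0), [23]), (Some (0, 1), [1, 11]), (Some (0, 2), [23])]),
  ([(1, 0, 2), (6, 0, 2)], 8, [(Some (2, 5), [32]), (Some (1, 4), [21]), (Some (1, 3), [17]),
     (Some (1, 2), [11]), (Some (0, 0), [24]), (Some (0, 1), [3, 11]), (Some (0, 2), [24])]),
  ([(1, 1, 2), (6, 0, 2)], 8, [(Some (2, 5), [32]), (Some (1, 4), [21]), (Some (1, 3), [19]),
     (Some (1, 2), [13]), (Some (0, 0), [28]), (Some (0, 1), [3, 13]), (Some (0, 2), [28])]),
  ([(2, 0, 2), (2, 0, 2), (3, 0, 1)], 8, [(Some (1, 0), [30]), (Some (2, 1), [16]), (Some (1, 0),
     [30]), (Some (2, 1), [16]), (Some (1, 0), [28]), (Some (2, 1), [11]), (Some (0, 0), [24])]),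
  ([(2, 0, 2), (5, 0, 0)], 4, [(None, [33]), (Some (2, 0), [21]), (None, [36]), (None, [29]),
     (Some (0, 0), [11]), (None, [29]), (None, [36])]),
  ([(7, 0, 0)], 4, [(None, [38]), (Some (1, 0), [21]), (Some (0, 0), [26]), (Some (0, 0), [29]),
     (Some (0, 1), [11]), (Some (0, 0), [21]), (None, [38])]),
  ([(1, 0, 2), (2, 0, 2), (5, 0, 0)], 8, [(Some (2, 1), [33]), (Some (1, 0), [33]), (Some (3, 2),
     [24]), (Some (1, 1), [24]), (Some (1, 0), [24]), (Some (2, 1), [3]), (Some (0, 0), [24]),
     (Some (0, 1), [24])]),
  ([(1, 0, 2), (7, 0, 2)], 8, [(Some (2, 0), [42]), (None, [44]), (Some (1, 4), [21]), (Some (0,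
     0), [3, 21]), (Some (0, 1), [3, 17]), (Some (0, 1), [24]), (Some (0, 0), [3, 21]), (Some (0,
     1), [3, 21])]),
  ([(2, 0, 2), (6, 0, 2)], 8, [(None, [44]), (Some (2, 5), [32]), (Some (1, 4), [21]), (Some (1,
     3), [31]), (Some (2, 1), [17]), (Some (0, 1), [24]), (Some (0, 1), [24]), (Some (2, 1),
     [33])]),
  ([(2, 1, 2), (6, 0, 2)], 8, [(None, [44]), (Some (2, 5), [32]), (Some (1, 4), [8, 21]), (Some
     (2, 1), [21]), (Some (2, 1), [19]), (Some (0, 0), [35]), (Some (0, 1), [25]), (Some (0, 2),
     [35])]),
  ([(3, 0, 2), (5, 0, 2)], 8, [(Some (1, 1), [32]), (Some (1, 0), [32]), (Some (2, 4), [21]),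
     (Some (2, 2), [21]), (Some (1, 2), [31]), (Some (1, 1), [17]), (Some (0, 1), [3, 17]), (Some
     (2, 2), [36])]),
  ([(1, 0, 1), (1, 1, 2), (7, 0, 2)], 10, [(Some (3, 5), [6, 32]), (Some (3, 6), [43]), (Some (1,
     4), [6, 21]), (Some (1, 4), [2, 21]), (Some (2, 0), [21]), (Some (1, 2), [2, 29]), (Some (0,
     1), [1, 28]), (Some (0, 2), [1, 28]), (Some (2, 0), [38])]),
  ([(3, 0, 1), (6, 0, 2)], 8, [(Some (1, 0), [45]), (Some (2, 5), [32]), (Some (0, 0), [44]),
     (Some (1, 4), [21]), (Some (2, 1), [4, 21]), (Some (1, 2), [30]), (Some (0, 0), [46]), (Some
     (0, 1), [3, 30]), (Some (0, 2), [46])]),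
  ([(9, 0, 2)], 8, [(Some (1, 1), [42]), (Some (1, 0), [42]), (Some (0, 0), [44]), (Some (0, 1),
     [3, 32]), (Some (0, 1), [11, 21]), (Some (1, 2), [47]), (Some (0, 1), [11, 21]), (Some (0,
     0), [44]), (Some (0, 1), [44])]),
  ([(1, 0, 1), (2, 0, 2), (7, 0, 2)], 10, [(Some (2, 1), [50]), (Some (2, 0), [50]), (Some (3, 6),
     [43]), (Some (1, 5), [9, 32]), (Some (1, 4), [9, 21]), (Some (2, 1), [1, 21]), (Some (1, 2),
     [23]), (Some (0, 1), [9, 24]), (Some (0, 2), [9, 24]), (Some (2, 1), [1, 38])]),
  ([(1, 0, 2), (2, 0, 2), (7, 0, 2)], 12, [(Some (2, 1), [50]), (Some (1, 0), [50]), (Some (3, 6),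
     [44]), (Some (1, 5), [11, 32]), (Some (1, 4), [11, 21]), (Some (2, 1), [3, 21]), (Some (1,
     2), [24]), (Some (0, 1), [11, 24]), (Some (0, 2), [11, 24]), (Some (2, 1), [3, 38])]),
  ([(1, 0, 2), (2, 1, 2), (7, 0, 2)], 12, [(Some (3, 6), [52]), (Some (1, 0), [50]), (Some (3, 6),
     [44]), (Some (1, 5), [12, 32]), (Some (1, 4), [12, 21]), (Some (2, 1), [4, 21]), (Some (1,
     2), [25]), (Some (0, 1), [3, 35]), (Some (0, 2), [3, 35]), (Some (2, 1), [4, 38])]),
  ([(5, 0, 0), (5, 0, 2)], 8, [(Some (1, 0), [53]), (Some (1, 1), [3, 32]), (Some (2, 4), [21]),
     (Some (0, 1), [3, 32]), (Some (0, 0), [53]), (Some (2, 0), [21, 21]), (Some (1, 2), [47]),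
     (Some (0, 0), [49]), (Some (0, 0), [49]), (Some (0, 1), [49])]),
  ([(1, 0, 1), (2, 0, 2), (2, 1, 2), (7, 0, 2)], 14, [(Some (2, 1), [59]), (Some (2, 0), [59]),
     (Some (3, 1), [54]), (Some (1, 0), [57]), (Some (2, 1), [0, 50]), (Some (2, 1), [2, 51]),
     (Some (3, 1), [14, 32]), (Some (3, 1), [14, 21]), (Some (3, 1), [14, 37]), (Some (0, 1), [23,
     25]), (Some (0, 2), [23, 25]), (Some (3, 1), [14, 38])]),
  ([(1, 0, 1), (11, 0, 2)], 10, [(Some (2, 4), [21, 42]), (Some (1, 9), [56]), (Some (1, 2), [9,
     42]), (Some (1, 1), [1, 42]), (Some (0, 0), [57]), (Some (0, 1), [1, 51]), (Some (0, 1), [1,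
     53]), (Some (0, 1), [1, 21, 21]), (Some (0, 1), [1, 53]), (Some (0, 0), [57]), (Some (0, 1),
     [1, 50]), (Some (0, 2), [57])]),
  ([(1, 0, 2), (11, 0, 1)], 10, [(Some (2, 4), [21, 41]), (Some (1, 3), [17, 41]), (Some (1, 2),
     [11, 41]), (Some (1, 1), [3, 41]), (Some (1, 6), [44]), (Some (1, 5), [26, 32]), (Some (1,
     2), [49, 8]), (Some (0, 1), [3, 20, 21]), (Some (1, 2), [11, 48]), (Some (0, 1), [10, 44]),
     (Some (0, 1), [1, 50]), (Some (0, 2), [58])]),
  ([(1, 1, 2), (4, 0, 1), (7, 0, 2)], 12, [(Some (2, 1), [59]), (Some (1, 1), [50, 5]), (Some (3,
     6), [45]), (Some (3, 6), [45]), (Some (0, 1), [4, 50]), (Some (1, 4), [6, 20, 21]), (Some (3,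
     0), [20, 32]), (Some (3, 0), [20, 21]), (Some (3, 0), [37, 20]), (Some (0, 1), [27, 28]),
     (Some (0, 2), [27, 28]), (Some (3, 0), [20, 38])]),
  ([(2, 0, 2), (3, 0, 1), (7, 0, 2)], 12, [(Some (2, 0), [59]), (Some (3, 6), [55]), (Some (1, 1),
     [58]), (Some (2, 1), [50]), (Some (0, 0), [58]), (Some (1, 5), [30, 32]), (Some (1, 4), [30,
     21]), (Some (3, 1), [16, 21]), (Some (1, 2), [46]), (Some (0, 1), [11, 46]), (Some (0, 2),
     [11, 46]), (Some (3, 1), [16, 38])]),
  ([(2, 0, 2), (10, 0, 0)], 8, [(Some (2, 0), [56]), (Some (2, 0), [56]), (Some (1, 1), [50]),
     (Some (1, 1), [51]), (Some (0, 0), [11, 48]), (None, [29, 38]), (Some (0, 1), [24]), (Some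
     (0, 0), [36, 21]), (None, [29, 38]), (Some (0, 0), [51]), (Some (0, 1), [51]), (Some (0, 1),
     [50])]),
  ([(2, 0, 2), (10, 0, 1)], 10, [(Some (2, 3), [17, 41]), (Some (2, 9), [56]), (Some (1, 6), [51,
     8]), (Some (1, 1), [11, 41]), (Some (1, 6), [51]), (Some (1, 5), [29, 32]), (Some (1, 4),
     [36, 21]), (Some (1, 1), [49, 8]), (Some (2, 1), [16, 38]), (Some (1, 1), [11, 48]), (Some
     (0, 0), [57]), (Some (0, 1), [58])]),
  ([(2, 1, 2), (10, 0, 2)], 12, [(Some (2, 3), [17, 42]), (Some (2, 9), [56]), (Some (2, 1),
     [56]), (Some (1, 1), [12, 42]), (Some (0, 0), [59]), (Some (0, 1), [3, 52]), (Some (0, 1),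
     [25, 32]), (Some (0, 2), [35, 21]), (Some (2, 1), [19, 38]), (Some (0, 1), [25, 32]), (Some
     (0, 0), [59]), (Some (0, 1), [59])]),
  ([(5, 0, 1), (7, 0, 2)], 10, [(Some (1, 1), [59]), (Some (2, 6), [55]), (Some (1, 1), [50]),
     (Some (0, 0), [57]), (Some (0, 1), [58]), (Some (2, 2), [51, 8]), (Some (2, 4), [21, 32]),
     (Some (2, 4), [21, 21]), (Some (2, 4), [37, 21]), (Some (2, 4), [36, 21]), (Some (2, 2), [49,
     8]), (Some (2, 4), [21, 38])]),
  ([(6, 0, 1), (6, 0, 2)], 10, [(Some (1, 2), [51, 8]), (Some (1, 1), [44, 8]), (Some (1, 2),
     [51]), (Some (0, 1), [10, 44]), (Some (0, 1), [1, 51]), (Some (2, 5), [60]), (Some (2, 3),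
     [8, 53]), (Some (2, 5), [21, 32]), (Some (2, 5), [53]), (Some (2, 5), [29, 32]), (Some (2,
     5), [26, 32]), (Some (2, 5), [60])]),
  ([(6, 0, 2), (6, 0, 2)], 12, [(Some (1, 4), [21, 39]), (Some (2, 5), [21, 32]), (Some (1, 2),
     [51]), (Some (0, 1), [3, 51]), (Some (0, 1), [3, 51]), (Some (2, 5), [60]), (Some (1, 4),
     [21, 39]), (Some (2, 5), [21, 32]), (Some (1, 2), [51]), (Some (0, 1), [3, 51]), (Some (0,
     1), [3, 51]), (Some (2, 5), [60])]),
  ([(1, 0, 1), (2, 1, 2), (11, 0, 2)], 14, [(Some (3, 4), [8, 21, 42]), (Some (1, 0), [62]), (Some
     (3, 4), [0, 21, 42]), (Some (1, 9), [8, 56]), (Some (2, 1), [2, 56]), (Some (1, 1), [14,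
     42]), (Some (0, 0), [61]), (Some (0, 1), [14, 51]), (Some (0, 1), [14, 53]), (Some (0, 1),
     [14, 21, 21]), (Some (0, 1), [14, 53]), (Some (0, 0), [61]), (Some (0, 1), [1, 59]), (Some
     (0, 2), [61])]),
  ([(1, 0, 2), (13, 0, 1)], 12, [(Some (2, 10), [68]), (Some (1, 9), [12, 56]), (Some (1, 9), [4,
     56]), (Some (1, 7), [59]), (Some (1, 7), [50, 18]), (Some (1, 6), [26, 45]), (Some (1, 5),
     [4, 60]), (Some (1, 4), [4, 21, 38]), (Some (1, 2), [25, 48]), (Some (0, 1), [27, 44]), (Some
     (0, 1), [16, 50]), (Some (0, 2), [58]), (Some (0, 1), [3, 56]), (Some (0, 2), [11, 56])]),
  ([(1, 1, 2), (2, 0, 2), (11, 0, 1)], 14, [(Some (2, 1), [63]), (Some (2, 0), [63]), (Some (3,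
     9), [5, 56]), (Some (1, 9), [13, 56]), (Some (1, 2), [28, 41]), (Some (1, 6), [5, 51]), (Some
     (1, 5), [5, 29, 32]), (Some (1, 4), [5, 36, 21]), (Some (2, 1), [33, 34]), (Some (2, 1), [4,
     20, 38]), (Some (1, 1), [11, 5, 48]), (Some (0, 1), [15, 51]), (Some (0, 1), [2, 58]), (Some
     (3, 0), [66])]),
  ([(1, 1, 2), (6, 0, 1), (7, 0, 2)], 14, [(Some (3, 6), [70]), (Some (2, 0), [69]), (Some (3, 6),
     [45, 20]), (Some (1, 1), [50, 5]), (Some (0, 1), [15, 50]), (Some (0, 1), [2, 58]), (Some (3,
     5), [6, 60]), (Some (2, 4), [5, 21, 39]), (Some (2, 4), [5, 21, 32]), (Some (2, 4), [5, 21,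
     21]), (Some (2, 4), [5, 37, 21]), (Some (2, 4), [5, 36, 21]), (Some (2, 4), [33, 5, 21]),
     (Some (2, 4), [5, 21, 38])]),
  ([(1, 1, 2), (6, 0, 2), (7, 0, 1)], 14, [(Some (3, 6), [71]), (Some (3, 5), [5, 32, 32]), (Some
     (3, 5), [5, 21, 32]), (Some (3, 5), [5, 53]), (Some (3, 5), [5, 29, 32]), (Some (3, 5), [26,
     5, 32]), (Some (3, 5), [5, 60]), (Some (1, 4), [5, 21, 39]), (Some (1, 4), [45, 21]), (Some
     (1, 2), [5, 51]), (Some (1, 1), [44, 5]), (Some (0, 1), [15, 51]), (Some (0, 2), [23, 45]),
     (Some (2, 4), [6, 21, 38])]),
  ([(2, 1, 2), (5, 0, 1), (7, 0, 2)], 14, [(Some (1, 0), [69]), (Some (2, 2), [61]), (Some (1, 1),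
     [59, 8]), (Some (3, 6), [8, 55]), (Some (1, 1), [59]), (Some (0, 0), [61]), (Some (0, 1),
     [58, 8]), (Some (2, 4), [52, 21]), (Some (3, 1), [34, 32]), (Some (3, 1), [34, 21]), (Some
     (3, 1), [34, 37]), (Some (3, 1), [34, 36]), (Some (3, 1), [33, 34]), (Some (3, 1), [34,
     38])]),
  ([(3, 0, 1), (11, 0, 2)], 12, [(Some (2, 4), [21, 42]), (Some (2, 4), [21, 42]), (Some (2, 4),
     [21, 42]), (Some (1, 9), [56]), (Some (1, 2), [30, 42]), (Some (1, 1), [16, 42]), (Some (0,
     0), [65]), (Some (0, 1), [11, 55]), (Some (0, 1), [16, 53]), (Some (0, 1), [16, 21, 21]),
     (Some (0, 1), [16, 53]), (Some (0, 0), [65]), (Some (0, 1), [16, 50]), (Some (0, 2), [65])]),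
  ([(14, 0, 2)], 12, [(Some (1, 6), [39, 42]), (Some (1, 5), [32, 42]), (Some (1, 4), [21, 42]),
     (Some (1, 3), [37, 42]), (Some (0, 1), [11, 56]), (Some (1, 1), [33, 42]), (Some (0, 1), [50,
     21]), (Some (0, 0), [71]), (Some (0, 1), [44, 32]), (Some (0, 1), [50, 21]), (Some (0, 4),
     [53, 21]), (Some (0, 1), [11, 56]), (Some (0, 2), [11, 56]), (Some (0, 6), [71])]),
  ([(14, 1, 1)], 12, [(Some (1, 10), [68]), (Some (1, 11), [62]), (Some (0, 1), [63]), (Some (0,
     2), [67]), (Some (1, 7), [64]), (Some (1, 7), [69]), (Some (1, 6), [70]), (Some (0, 6),
     [70]), (Some (0, 7), [69]), (Some (0, 7), [64]), (Some (1, 2), [67]), (Some (1, 1), [63]),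
     (Some (0, 11), [62]), (Some (0, 10), [68])]),
  ([(16, 1, 1)], 14, [(Some (1, 14), [79]), (Some (1, 11), [72]), (Some (0, 1), [73]), (Some (1,
     11), [78]), (Some (0, 2), [74]), (Some (1, 7), [77]), (Some (1, 7), [75]), (Some (1, 6),
     [76]), (Some (0, 6), [76]), (Some (0, 7), [75]), (Some (0, 7), [77]), (Some (1, 2), [74]),
     (Some (0, 11), [78]), (Some (1, 1), [73]), (Some (0, 11), [72]), (Some (0, 14), [79])])]"

lemma check_maker_table: "list_all (check_entry 0 2 1 (bounds maker_table)) maker_table"
  by code_simp

text \<open>The lengths 2, 4 and 6 secure their full length; joined with each other they give 8, 10
  and 12 at a loss of 2. With these values every cut of 14 or 16 into even parts falls at least 2
  short of 12 and 14, so these two lengths are taken from the table itself.\<close>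

lemma maker_base:
  "secures 0 2 1 {#(2, 1, 1)#} 2" "secures 0 2 1 {#(4, 1, 1)#} 4" "secures 0 2 1 {#(6, 1, 1)#} 6"
  "secures 0 2 1 {#(14, 1, 1)#} 12" "secures 0 2 1 {#(16, 1, 1)#} 14"
proof -
  have "list_all (\<lambda>e. e \<in> set (bounds maker_table))
      [([(2, 1, 1)], 2), ([(4, 1, 1)], 4), ([(6, 1, 1)], 6), ([(14, 1, 1)], 12), ([(16, 1, 1)], 14)]"
    by code_simp
  with check_sound[OF check_maker_table]
  have "secures 0 2 1 (mset [(2, 1, 1)]) 2" "secures 0 2 1 (mset [(4, 1, 1)]) 4"
    "secures 0 2 1 (mset [(6, 1, 1)]) 6" "secures 0 2 1 (mset [(14, 1, 1)]) 12"
    "secures 0 2 1 (mset [(16, 1, 1)]) 14"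
    by (simp_all only: list.pred_inject simp_thms)
  then show "secures 0 2 1 {#(2, 1, 1)#} 2" "secures 0 2 1 {#(4, 1, 1)#} 4"
    "secures 0 2 1 {#(6, 1, 1)#} 6" "secures 0 2 1 {#(14, 1, 1)#} 12" "secures 0 2 1 {#(16, 1, 1)#} 14"
    by simp_all
qed

text \<open>The negated bounds are upper bounds on S. Positions with several segments have entries
  of their own because a joint bound can beat the sum: one \<open>(1, 0, 1)\<close> alone may bring
  Admirable 2, but of two such segments Impish spoils the second, so both together bring no more
  than 2.\<close>

definition breaker_table :: "cert list" where
  "breaker_table = [
  ([(1, 0, 0)], 0, [(None, [])]),
  ([(1, 0, 1)], -2, [(None, [])]),
  ([(1, 0, 2)], -4, [(None, [])]),
  ([(1, 1, 2)], -6, [(None, [])]),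
  ([(1, 0, 1), (1, 0, 1)], -2, [(Some (2, 0), []), (Some (2, 0), [])]),
  ([(1, 0, 1), (1, 0, 2)], -4, [(Some (2, 0), []), (Some (2, 0), [])]),
  ([(1, 0, 2), (1, 0, 2)], -4, [(Some (2, 0), []), (Some (2, 0), [])]),
  ([(1, 0, 2), (1, 1, 2)], -6, [(Some (2, 0), []), (Some (2, 0), [])]),
  ([(1, 1, 2), (1, 1, 2)], -6, [(Some (2, 0), []), (Some (2, 0), [])]),
  ([(1, 1, 2), (1, 2, 2)], -8, [(Some (2, 0), []), (Some (2, 0), [])]),
  ([(1, 2, 2), (1, 2, 2)], -8, [(Some (2, 0), []), (Some (2, 0), [])]),
  ([(2, 0, 0)], 0, [(Some (1, 0), []), (Some (0, 0), [])]),
  ([(2, 0, 1)], -2, [(Some (1, 0), []), (Some (0, 0), [])]),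
  ([(2, 0, 2)], -4, [(Some (1, 0), []), (Some (0, 0), [])]),
  ([(2, 1, 1)], -2, [(Some (1, 0), []), (Some (0, 0), [])]),
  ([(2, 1, 2)], -4, [(Some (1, 0), []), (Some (0, 0), [])]),
  ([(2, 2, 2)], -4, [(Some (1, 0), []), (Some (0, 0), [])]),
  ([(1, 1, 2), (2, 0, 1)], -6, [(Some (2, 1), [0]), (None, [8]), (Some (2, 0), [2])]),
  ([(1, 2, 2), (2, 0, 2)], -8, [(Some (2, 1), [0]), (None, [10]), (Some (2, 0), [2])]),
  ([(3, 0, 2)], -4, [(None, [16]), (Some (1, 0), [2]), (Some (0, 1), [0])]),
  ([(3, 1, 2)], -6, [(None, [16]), (Some (1, 0), [3]), (Some (0, 1), [1])]),
  ([(3, 2, 2)], -8, [(None, [16]), (None, [10]), (None, [16])]),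
  ([(1, 0, 2), (3, 2, 2)], -8, [(Some (2, 0), [13]), (Some (1, 0), [6]), (Some (2, 0), [10]),
     (Some (0, 0), [6])]),
  ([(1, 1, 2), (3, 0, 1)], -6, [(Some (2, 2), [11]), (Some (1, 0), [7]), (Some (0, 0), [8]), (Some
     (2, 0), [13])]),
  ([(1, 1, 2), (3, 0, 2)], -8, [(Some (2, 2), [11]), (Some (1, 0), [7]), (Some (0, 0), [9]), (Some
     (2, 0), [13])]),
  ([(1, 1, 2), (3, 2, 2)], -10, [(Some (2, 0), [13]), (Some (1, 0), [7]), (Some (0, 0), [9]),
     (Some (0, 0), [7])]),
  ([(1, 2, 2), (3, 0, 2)], -8, [(Some (2, 2), [11]), (Some (2, 0), [16]), (Some (0, 0), [10]),
     (Some (2, 0), [13])]),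
  ([(4, 0, 0)], -4, [(None, [19]), (Some (0, 0), [13]), (Some (0, 0), [6]), (None, [19])]),
  ([(4, 0, 1)], -4, [(Some (1, 0), [13]), (Some (0, 0), [15]), (Some (1, 0), [13]), (Some (0, 2),
     [11])]),
  ([(4, 0, 2)], -4, [(Some (1, 0), [13]), (Some (0, 0), [16]), (Some (1, 0), [13]), (Some (0, 2),
     [11])]),
  ([(4, 1, 2)], -6, [(Some (1, 0), [13]), (Some (0, 0), [16]), (Some (1, 0), [15]), (Some (0, 2),
     [12])]),
  ([(4, 2, 2)], -8, [(Some (1, 0), [13]), (Some (0, 0), [16]), (Some (1, 0), [16]), (Some (0, 0),
     [13])]),
  ([(1, 0, 1), (1, 0, 2), (3, 0, 1)], -6, [(Some (3, 1), [0, 5]), (Some (3, 1), [0, 4]), (Some (1,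
     0), [1, 6]), (Some (1, 0), [1, 6]), (Some (0, 1), [0, 5])]),
  ([(1, 0, 2), (2, 0, 1), (2, 0, 1)], -6, [(Some (2, 1), [0, 12]), (Some (1, 0), [2, 12]), (Some
     (3, 1), [0, 6]), (Some (1, 0), [2, 12]), (Some (2, 1), [0, 6])]),
  ([(1, 0, 2), (4, 0, 0)], -4, [(Some (2, 1), [0, 11]), (Some (1, 1), [0, 6]), (Some (1, 1), [0,
     6]), (Some (0, 1), [0, 6]), (Some (0, 1), [0, 6])]),
  ([(1, 0, 2), (4, 0, 1)], -6, [(Some (2, 1), [0, 12]), (Some (1, 1), [1, 6]), (Some (1, 1), [1,
     6]), (Some (0, 1), [0, 7]), (Some (0, 1), [0, 6])]),
  ([(1, 1, 2), (4, 0, 0)], -6, [(Some (2, 1), [0, 11]), (Some (1, 1), [0, 7]), (Some (1, 1), [0,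
     7]), (Some (0, 1), [0, 7]), (Some (0, 1), [0, 7])]),
  ([(1, 1, 2), (4, 1, 2)], -10, [(Some (2, 0), [19]), (Some (2, 0), [21]), (None, [8, 16]), (Some
     (0, 1), [1, 9]), (Some (0, 2), [17])]),
  ([(5, 0, 1)], -6, [(None, [30]), (Some (0, 0), [20]), (Some (0, 1), [0, 15]), (Some (0, 1), [0,
     7]), (None, [29])]),
  ([(5, 1, 2)], -8, [(Some (1, 0), [19]), (Some (0, 0), [21]), (None, [15, 16]), (Some (0, 0),
     [18]), (Some (0, 0), [19])]),
  ([(5, 2, 2)], -8, [(Some (1, 0), [19]), (Some (0, 0), [21]), (None, [16, 16]), (Some (0, 0),
     [18]), (Some (0, 0), [19])]),
  ([(1, 1, 2), (5, 1, 2)], -10, [(Some (2, 0), [29]), (Some (1, 0), [24]), (Some (0, 0), [25]),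
     (Some (0, 0), [7, 16]), (Some (0, 2), [9, 12]), (Some (0, 3), [23])]),
  ([(3, 2, 2), (3, 2, 2)], -12, [(Some (1, 0), [22]), (Some (2, 0), [10, 13]), (Some (0, 0),
     [22]), (Some (1, 0), [22]), (Some (2, 0), [10, 13]), (Some (0, 0), [22])]),
  ([(6, 2, 2)], -8, [(Some (1, 0), [29]), (Some (0, 0), [31]), (Some (0, 0), [22]), (Some (0, 0),
     [13, 16]), (Some (0, 0), [26]), (Some (0, 0), [29])]),
  ([(1, 0, 1), (1, 0, 2), (5, 1, 2)], -10, [(Some (2, 0), [39]), (Some (3, 0), [1, 29]), (Some (1,
     0), [5, 19]), (Some (0, 0), [1, 22]), (Some (0, 0), [1, 6, 16]), (Some (1, 0), [5, 20]),
     (Some (0, 3), [32])]),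
  ([(1, 0, 2), (1, 1, 2), (5, 0, 1)], -10, [(Some (2, 0), [38]), (Some (3, 4), [34]), (Some (1,
     0), [7, 19]), (Some (1, 2), [6, 17]), (Some (0, 1), [0, 7, 15]), (Some (0, 1), [0, 6, 8]),
     (Some (2, 0), [2, 29])]),
  ([(1, 0, 2), (2, 0, 1), (4, 1, 2)], -10, [(Some (2, 1), [0, 30]), (Some (1, 0), [2, 30]), (Some
     (3, 0), [6, 19]), (Some (2, 1), [0, 22]), (Some (0, 0), [2, 12, 16]), (Some (1, 0), [2, 12,
     15]), (Some (0, 2), [33])]),
  ([(1, 0, 2), (6, 0, 2)], -8, [(Some (2, 1), [0, 29]), (Some (1, 0), [2, 29]), (Some (1, 0), [6,
     19]), (Some (0, 1), [0, 22]), (Some (0, 1), [0, 6, 16]), (Some (1, 0), [2, 29]), (Some (0,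
     4), [34])]),
  ([(1, 0, 2), (6, 1, 2)], -10, [(Some (2, 1), [1, 29]), (Some (1, 0), [2, 29]), (Some (1, 0), [7,
     19]), (Some (0, 1), [1, 22]), (Some (0, 1), [1, 6, 16]), (Some (1, 0), [2, 30]), (Some (0,
     4), [35])]),
  ([(1, 1, 2), (2, 0, 2), (4, 0, 1)], -10, [(Some (2, 1), [0, 28]), (Some (1, 0), [3, 28]), (Some
     (2, 0), [35]), (Some (1, 2), [17, 13]), (Some (2, 1), [0, 7, 15]), (Some (0, 1), [0, 8, 13]),
     (Some (2, 1), [0, 24])]),
  ([(1, 1, 2), (6, 0, 2)], -10, [(Some (2, 1), [0, 29]), (Some (1, 0), [3, 29]), (Some (1, 0), [7,
     19]), (Some (0, 1), [0, 25]), (Some (0, 1), [0, 7, 16]), (Some (1, 0), [3, 29]), (Some (0,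
     4), [36])]),
  ([(2, 0, 1), (2, 0, 1), (3, 2, 2)], -10, [(Some (1, 0), [12, 21]), (Some (2, 1), [0, 22]), (Some
     (1, 0), [12, 21]), (Some (2, 1), [0, 22]), (Some (1, 0), [33]), (Some (2, 1), [0, 10, 12]),
     (Some (0, 0), [33])]),
  ([(2, 0, 1), (5, 0, 1)], -6, [(Some (1, 0), [38]), (Some (2, 4), [34]), (Some (1, 0), [12, 19]),
     (Some (1, 2), [33]), (Some (0, 1), [0, 12, 15]), (Some (0, 2), [17, 11]), (Some (2, 1), [0,
     29])]),
  ([(2, 1, 2), (5, 0, 2)], -10, [(Some (2, 1), [0, 26]), (Some (2, 4), [36]), (Some (1, 0), [15,
     19]), (Some (2, 1), [1, 22]), (Some (0, 1), [0, 15, 16]), (Some (1, 0), [15, 19]), (Some (2,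
     1), [1, 29])]),
  ([(3, 0, 1), (4, 0, 1)], -6, [(Some (1, 0), [35]), (Some (1, 0), [35]), (Some (0, 1), [0, 28]),
     (Some (1, 1), [32]), (Some (1, 1), [32]), (Some (0, 1), [0, 23]), (Some (2, 2), [11, 19])]),
  ([(3, 2, 2), (4, 0, 0)], -8, [(Some (1, 0), [34]), (Some (2, 1), [0, 10, 11]), (Some (0, 0),
     [34]), (Some (1, 1), [0, 22]), (Some (1, 1), [0, 22]), (Some (0, 1), [0, 22]), (Some (0, 1),
     [0, 22])]),
  ([(3, 2, 2), (4, 0, 1)], -10, [(Some (1, 0), [35]), (Some (2, 1), [0, 10, 12]), (Some (0, 0),
     [35]), (Some (1, 1), [1, 22]), (Some (1, 1), [1, 22]), (Some (0, 1), [0, 25]), (Some (0, 1),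
     [0, 22])]),
  ([(7, 0, 0)], -4, [(Some (1, 1), [0, 29]), (Some (1, 4), [34]), (Some (0, 1), [0, 29]), (Some
     (0, 2), [11, 19]), (Some (1, 1), [0, 29]), (Some (0, 4), [34]), (Some (0, 1), [0, 29])]),
  ([(7, 0, 1)], -6, [(Some (1, 1), [1, 29]), (Some (1, 4), [35]), (Some (0, 1), [0, 30]), (Some
     (0, 2), [11, 20]), (Some (1, 1), [1, 29]), (Some (0, 4), [36]), (Some (0, 1), [0, 29])]),
  ([(7, 0, 2)], -8, [(None, [43]), (Some (0, 0), [40]), (Some (0, 1), [0, 31]), (Some (0, 1), [0,
     22]), (None, [16, 29]), (Some (0, 1), [0, 26]), (Some (0, 1), [0, 29])]),
  ([(7, 1, 2)], -10, [(None, [43]), (Some (0, 0), [40]), (Some (0, 1), [1, 31]), (Some (0, 1), [1,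
     22]), (None, [16, 30]), (Some (0, 1), [1, 26]), (Some (0, 1), [1, 29])]),
  ([(2, 0, 1), (2, 0, 1), (4, 0, 0)], -6, [(Some (1, 0), [12, 27]), (Some (2, 1), [0, 34]), (Some
     (1, 0), [12, 27]), (Some (2, 1), [0, 34]), (Some (1, 1), [0, 33]), (Some (1, 1), [0, 33]),
     (Some (0, 1), [0, 33]), (Some (0, 1), [0, 33])]),
  ([(4, 0, 0), (4, 0, 0)], -4, [(Some (1, 1), [0, 34]), (Some (1, 1), [0, 34]), (Some (0, 1), [0,
     34]), (Some (0, 1), [0, 34]), (Some (1, 1), [0, 34]), (Some (1, 1), [0, 34]), (Some (0, 1),
     [0, 34]), (Some (0, 1), [0, 34])]),
  ([(4, 0, 0), (4, 0, 1)], -6, [(Some (1, 1), [0, 35]), (Some (1, 1), [0, 35]), (Some (0, 1), [0,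
     35]), (Some (0, 1), [0, 35]), (Some (1, 1), [1, 34]), (Some (1, 1), [1, 34]), (Some (0, 1),
     [0, 36]), (Some (0, 1), [0, 34])]),
  ([(8, 1, 2)], -10, [(Some (1, 2), [13, 29]), (Some (0, 0), [43]), (Some (0, 1), [1, 40]), (Some
     (0, 2), [12, 31]), (Some (0, 2), [22, 12]), (Some (0, 0), [16, 29]), (Some (0, 2), [26, 12]),
     (Some (0, 2), [12, 29])]),
  ([(1, 0, 2), (1, 1, 2), (7, 1, 2)], -14, [(Some (2, 0), [60]), (Some (3, 0), [47]), (Some (2,
     0), [2, 43]), (Some (0, 0), [7, 40]), (Some (1, 0), [7, 15, 19]), (Some (0, 2), [22, 17]),
     (Some (0, 0), [7, 16, 19]), (Some (0, 4), [35, 9]), (Some (0, 5), [45])]),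
  ([(1, 0, 2), (4, 1, 2), (4, 1, 2)], -14, [(Some (2, 0), [19, 30]), (Some (3, 0), [22, 19]),
     (Some (0, 0), [2, 16, 30]), (Some (1, 0), [2, 15, 30]), (Some (0, 2), [46]), (Some (2, 0),
     [22, 19]), (Some (0, 0), [2, 16, 30]), (Some (1, 0), [2, 15, 30]), (Some (0, 2), [46])]),
  ([(1, 0, 2), (8, 2, 2)], -12, [(Some (2, 0), [59]), (Some (1, 0), [47]), (Some (0, 0), [2, 43]),
     (Some (0, 0), [6, 40]), (Some (1, 0), [22, 19]), (Some (0, 0), [22, 19]), (Some (0, 0), [2,
     16, 29]), (Some (1, 0), [2, 43]), (Some (0, 0), [47])]),
  ([(1, 1, 2), (3, 2, 2), (5, 0, 1)], -14, [(Some (3, 4), [55]), (Some (1, 0), [45]), (Some (0,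
     0), [9, 38]), (Some (0, 0), [45]), (Some (1, 0), [25, 19]), (Some (1, 2), [22, 17]), (Some
     (0, 1), [0, 25, 15]), (Some (0, 1), [0, 22, 8]), (Some (3, 0), [21, 29])]),
  ([(1, 1, 2), (8, 0, 1)], -10, [(Some (2, 7), [57]), (Some (1, 0), [50]), (Some (1, 5), [45]),
     (Some (0, 1), [0, 41]), (Some (0, 2), [37, 11]), (Some (1, 2), [17, 29]), (Some (0, 4), [36,
     15]), (Some (0, 1), [0, 8, 29]), (Some (2, 0), [59])]),
  ([(2, 0, 1), (3, 2, 2), (4, 1, 2)], -14, [(Some (1, 0), [21, 30]), (Some (3, 0), [22, 19]),
     (Some (1, 0), [46]), (Some (2, 1), [0, 10, 30]), (Some (0, 0), [46]), (Some (3, 1), [0, 42]),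
     (Some (0, 0), [12, 16, 21]), (Some (1, 0), [12, 15, 21]), (Some (0, 2), [51])]),
  ([(2, 0, 1), (7, 1, 2)], -10, [(Some (1, 0), [60]), (Some (2, 0), [47]), (Some (2, 1), [0, 43]),
     (Some (0, 0), [12, 40]), (Some (1, 0), [12, 15, 19]), (Some (0, 2), [51]), (Some (0, 0), [12,
     16, 19]), (Some (1, 0), [12, 39]), (Some (0, 5), [52])]),
  ([(3, 2, 2), (6, 0, 2)], -12, [(Some (1, 0), [47]), (Some (2, 1), [0, 10, 29]), (Some (0, 0),
     [47]), (Some (1, 0), [21, 29]), (Some (1, 0), [22, 19]), (Some (0, 1), [0, 42]), (Some (0,
     1), [0, 22, 16]), (Some (1, 0), [21, 29]), (Some (0, 4), [55])]),
  ([(4, 0, 1), (5, 1, 2)], -10, [(Some (1, 1), [44]), (Some (1, 1), [44]), (Some (0, 1), [0, 41]),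
     (Some (0, 2), [11, 39]), (Some (1, 0), [19, 28]), (Some (0, 0), [56]), (Some (0, 0), [35,
     16]), (Some (1, 0), [20, 28]), (Some (0, 3), [54])]),
  ([(4, 1, 2), (5, 0, 1)], -10, [(Some (2, 4), [55]), (Some (0, 0), [16, 38]), (Some (1, 0), [15,
     38]), (Some (0, 2), [52]), (Some (1, 0), [19, 30]), (Some (1, 2), [46]), (Some (0, 1), [0,
     15, 30]), (Some (0, 2), [37, 11]), (Some (2, 0), [19, 29])]),
  ([(9, 0, 2)], -8, [(Some (1, 0), [59]), (Some (1, 0), [47]), (Some (0, 1), [0, 43]), (Some (0,
     2), [11, 40]), (Some (1, 0), [19, 29]), (Some (0, 4), [55]), (Some (0, 1), [0, 16, 29]),
     (Some (1, 0), [59]), (Some (0, 7), [57])]),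
  ([(9, 1, 2)], -10, [(Some (1, 0), [59]), (Some (1, 0), [50]), (Some (0, 1), [1, 43]), (Some (0,
     2), [12, 40]), (Some (1, 0), [19, 30]), (Some (0, 4), [56]), (Some (0, 1), [1, 16, 29]),
     (Some (1, 0), [60]), (Some (0, 7), [58])]),
  ([(9, 2, 2)], -12, [(Some (1, 0), [59]), (Some (1, 2), [18, 29]), (None, [16, 43]), (Some (0,
     0), [13, 40]), (Some (0, 0), [19, 31]), (Some (0, 0), [21, 29]), (None, [16, 43]), (Some (0,
     2), [18, 29]), (Some (0, 0), [59])]),
  ([(1, 0, 1), (1, 0, 2), (8, 0, 1)], -10, [(Some (3, 7), [2, 57]), (Some (3, 7), [1, 57]), (Some
     (1, 0), [1, 47]), (Some (1, 1), [4, 6, 29]), (Some (0, 1), [0, 44]), (Some (0, 2), [5, 11,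
     30]), (Some (1, 1), [4, 6, 29]), (Some (0, 4), [1, 34, 15]), (Some (1, 0), [1, 47]), (Some
     (0, 2), [5, 11, 29])]),
  ([(1, 0, 2), (2, 0, 1), (7, 0, 1)], -10, [(Some (2, 1), [0, 58]), (Some (1, 0), [2, 58]), (Some
     (3, 2), [6, 11, 28]), (Some (1, 1), [5, 12, 29]), (Some (1, 0), [6, 12, 29]), (Some (0, 1),
     [0, 46]), (Some (1, 2), [33, 19]), (Some (0, 2), [6, 11, 12, 15]), (Some (0, 4), [34, 17]),
     (Some (2, 1), [0, 47])]),
  ([(1, 0, 2), (4, 0, 1), (5, 0, 1)], -10, [(Some (2, 1), [0, 52]), (Some (1, 2), [2, 52]), (Some
     (3, 2), [6, 11, 12, 15]), (Some (0, 1), [0, 45]), (Some (3, 4), [34, 19]), (Some (1, 0), [35,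
     19]), (Some (1, 2), [6, 12, 28]), (Some (0, 1), [0, 35, 15]), (Some (0, 2), [7, 11, 28]),
     (Some (0, 2), [6, 11, 28])]),
  ([(1, 0, 2), (9, 0, 0)], -8, [(Some (2, 1), [0, 57]), (Some (1, 1), [0, 47]), (Some (1, 2), [6,
     11, 29]), (Some (0, 1), [0, 47]), (Some (1, 4), [34, 19]), (Some (0, 2), [6, 11, 29]), (Some
     (0, 4), [34, 19]), (Some (1, 1), [0, 47]), (Some (0, 2), [6, 11, 29]), (Some (0, 1), [0,
     47])]),
  ([(1, 0, 2), (9, 0, 1)], -10, [(Some (2, 1), [0, 58]), (Some (1, 1), [1, 47]), (Some (1, 2), [6,
     12, 29]), (Some (0, 1), [0, 48]), (Some (1, 4), [35, 19]), (Some (0, 2), [6, 11, 30]), (Some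
     (0, 4), [34, 20]), (Some (1, 1), [1, 47]), (Some (0, 2), [7, 11, 29]), (Some (0, 1), [0,
     47])]),
  ([(1, 1, 2), (9, 0, 0)], -10, [(Some (2, 1), [0, 57]), (Some (1, 1), [0, 50]), (Some (1, 2), [7,
     11, 29]), (Some (0, 1), [0, 50]), (Some (1, 4), [36, 19]), (Some (0, 2), [7, 11, 29]), (Some
     (0, 4), [36, 19]), (Some (1, 1), [0, 50]), (Some (0, 2), [7, 11, 29]), (Some (0, 1), [0,
     50])]),
  ([(1, 2, 2), (4, 0, 0), (5, 1, 2)], -14, [(Some (3, 4), [63]), (Some (2, 0), [19, 39]), (Some
     (3, 4), [35, 18]), (Some (3, 4), [35, 18]), (Some (2, 0), [19, 39]), (Some (1, 0), [26, 27]),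
     (Some (1, 0), [36, 18]), (Some (3, 0), [15, 16, 27]), (Some (0, 1), [1, 34, 10]), (Some (3,
     0), [27, 30])]),
  ([(2, 0, 1), (2, 0, 1), (6, 0, 2)], -10, [(Some (2, 1), [0, 50]), (Some (2, 1), [0, 47]), (Some
     (2, 1), [0, 50]), (Some (2, 1), [0, 47]), (Some (1, 0), [12, 12, 29]), (Some (1, 0), [33,
     19]), (Some (0, 1), [0, 51]), (Some (0, 1), [0, 33, 16]), (Some (1, 0), [12, 12, 29]), (Some
     (0, 4), [61])]),
  ([(2, 0, 1), (4, 0, 0), (4, 1, 2)], -10, [(Some (1, 0), [27, 30]), (Some (3, 0), [34, 19]),
     (Some (1, 1), [0, 46]), (Some (1, 1), [0, 46]), (Some (0, 1), [0, 46]), (Some (0, 1), [0,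
     46]), (Some (3, 1), [0, 55]), (Some (0, 0), [12, 16, 27]), (Some (1, 0), [12, 15, 27]), (Some
     (0, 2), [61])]),
  ([(4, 0, 0), (6, 0, 2)], -8, [(Some (1, 1), [0, 47]), (Some (1, 1), [0, 47]), (Some (0, 1), [0,
     47]), (Some (0, 1), [0, 47]), (Some (1, 0), [27, 29]), (Some (1, 0), [34, 19]), (Some (0, 1),
     [0, 55]), (Some (0, 1), [0, 34, 16]), (Some (1, 0), [27, 29]), (Some (0, 4), [62])]),
  ([(4, 0, 1), (6, 0, 2)], -10, [(Some (1, 1), [1, 47]), (Some (1, 1), [1, 47]), (Some (0, 1), [0,
     50]), (Some (0, 1), [0, 47]), (Some (1, 0), [28, 29]), (Some (1, 0), [35, 19]), (Some (0, 1),
     [0, 56]), (Some (0, 1), [0, 35, 16]), (Some (1, 0), [28, 29]), (Some (0, 4), [63])]),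
  ([(5, 0, 1), (5, 0, 2)], -10, [(Some (2, 0), [29, 30]), (Some (2, 4), [34, 20]), (Some (0, 1),
     [0, 53]), (Some (2, 4), [36, 19]), (Some (2, 0), [29, 29]), (Some (1, 0), [19, 38]), (Some
     (2, 2), [22, 11, 12]), (Some (0, 1), [0, 16, 38]), (Some (1, 0), [19, 38]), (Some (2, 2),
     [11, 12, 29])]),
  ([(10, 0, 1)], -10, [(None, [76]), (Some (0, 0), [64]), (Some (0, 1), [0, 60]), (Some (0, 1),
     [0, 48]), (Some (1, 0), [29, 29]), (Some (0, 0), [29, 30]), (Some (0, 1), [0, 20, 29]), (Some
     (0, 1), [0, 53]), (Some (0, 1), [0, 50]), (None, [75])]),
  ([(10, 1, 2)], -12, [(Some (1, 4), [29, 29]), (Some (1, 3), [24, 29]), (Some (1, 2), [13, 15,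
     29]), (Some (0, 0), [13, 43]), (Some (0, 0), [19, 40]), (Some (0, 0), [29, 31]), (Some (0,
     4), [22, 28]), (Some (0, 2), [12, 16, 29]), (Some (0, 4), [26, 28]), (Some (0, 4), [28,
     29])]),
  ([(1, 1, 2), (10, 1, 2)], -14, [(Some (2, 0), [75]), (Some (2, 0), [77]), (Some (1, 0), [8,
     59]), (Some (1, 0), [50, 15]), (Some (0, 2), [17, 43]), (Some (0, 3), [23, 40]), (Some (1,
     0), [41, 19]), (Some (0, 5), [68]), (Some (0, 0), [50, 16]), (Some (0, 7), [9, 58]), (Some
     (0, 8), [69])]),
  ([(4, 1, 2), (7, 1, 2)], -14, [(Some (2, 0), [72]), (Some (0, 0), [16, 60]), (Some (1, 0), [15,
     60]), (Some (0, 2), [71]), (Some (2, 0), [19, 43]), (Some (0, 0), [30, 40]), (Some (1, 0),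
     [15, 19, 30]), (Some (0, 2), [70]), (Some (0, 0), [16, 19, 30]), (Some (1, 0), [30, 39]),
     (Some (0, 5), [74])]),
  ([(11, 2, 2)], -12, [(Some (1, 0), [75]), (Some (0, 0), [77]), (Some (0, 0), [67]), (Some (1,
     0), [72]), (Some (0, 0), [19, 43]), (Some (0, 0), [29, 40]), (Some (1, 0), [19, 43]), (Some
     (0, 0), [72]), (Some (0, 0), [16, 59]), (Some (1, 0), [77]), (Some (0, 0), [75])]),
  ([(1, 0, 2), (2, 0, 1), (9, 1, 2)], -14, [(Some (2, 1), [0, 76]), (Some (1, 0), [2, 76]), (Some
     (3, 4), [6, 28, 29]), (Some (2, 1), [0, 67]), (Some (1, 0), [47, 17]), (Some (0, 0), [6, 12,
     43]), (Some (0, 2), [33, 40]), (Some (1, 0), [46, 19]), (Some (0, 0), [22, 12, 29]), (Some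
     (0, 1), [5, 12, 16, 29]), (Some (1, 0), [2, 71]), (Some (0, 7), [79])]),
  ([(1, 0, 2), (4, 0, 1), (7, 1, 2)], -14, [(Some (2, 1), [0, 71]), (Some (1, 2), [2, 71]), (Some
     (3, 2), [6, 12, 15, 29]), (Some (0, 1), [0, 65]), (Some (3, 0), [47, 19]), (Some (1, 1), [6,
     28, 29]), (Some (0, 0), [35, 40]), (Some (1, 0), [35, 15, 19]), (Some (0, 2), [22, 12, 28]),
     (Some (0, 0), [35, 16, 19]), (Some (1, 0), [2, 73]), (Some (0, 5), [80])]),
  ([(1, 0, 2), (4, 1, 2), (7, 0, 1)], -14, [(Some (2, 0), [19, 58]), (Some (3, 2), [22, 11, 28]),
     (Some (0, 0), [2, 16, 58]), (Some (1, 0), [2, 15, 58]), (Some (0, 2), [79]), (Some (1, 1),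
     [5, 29, 30]), (Some (1, 0), [6, 29, 30]), (Some (0, 1), [0, 66]), (Some (1, 2), [46, 19]),
     (Some (0, 2), [6, 11, 15, 30]), (Some (0, 4), [34, 37]), (Some (2, 0), [47, 19])]),
  ([(1, 0, 2), (11, 0, 2)], -12, [(Some (2, 1), [0, 75]), (Some (1, 0), [2, 75]), (Some (1, 4),
     [6, 29, 29]), (Some (0, 1), [0, 67]), (Some (1, 0), [47, 19]), (Some (0, 2), [6, 11, 43]),
     (Some (0, 4), [34, 40]), (Some (1, 0), [47, 19]), (Some (0, 2), [22, 11, 29]), (Some (0, 1),
     [0, 47, 16]), (Some (1, 0), [2, 75]), (Some (0, 9), [81])]),
  ([(1, 0, 2), (11, 1, 2)], -14, [(Some (2, 1), [1, 75]), (Some (1, 0), [2, 75]), (Some (1, 4),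
     [7, 29, 29]), (Some (0, 1), [1, 67]), (Some (1, 0), [47, 20]), (Some (0, 2), [6, 12, 43]),
     (Some (0, 4), [35, 40]), (Some (1, 0), [48, 19]), (Some (0, 2), [22, 12, 29]), (Some (0, 1),
     [1, 47, 16]), (Some (1, 0), [2, 76]), (Some (0, 9), [82])]),
  ([(1, 1, 2), (4, 0, 1), (7, 0, 2)], -14, [(Some (3, 2), [11, 28, 29]), (Some (1, 2), [17, 59]),
     (Some (3, 2), [7, 11, 15, 29]), (Some (0, 1), [0, 8, 59]), (Some (2, 0), [19, 59]), (Some (1,
     1), [7, 28, 29]), (Some (1, 0), [7, 28, 29]), (Some (1, 0), [49, 19]), (Some (0, 2), [25, 11,
     28]), (Some (0, 1), [0, 49, 16]), (Some (0, 4), [9, 63]), (Some (3, 0), [88])]),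
  ([(1, 1, 2), (5, 0, 1), (6, 0, 2)], -14, [(Some (2, 4), [87]), (Some (1, 0), [50, 19]), (Some
     (1, 2), [47, 17]), (Some (0, 1), [0, 50, 15]), (Some (0, 1), [0, 47, 8]), (Some (3, 2), [24,
     11, 29]), (Some (1, 1), [45, 19]), (Some (1, 0), [45, 19]), (Some (0, 1), [0, 68]), (Some (0,
     1), [0, 45, 16]), (Some (2, 2), [9, 11, 12, 29]), (Some (3, 0), [89])]),
  ([(2, 0, 1), (2, 0, 1), (8, 2, 2)], -14, [(Some (3, 0), [17, 59]), (Some (2, 1), [0, 67]), (Some
     (3, 0), [17, 59]), (Some (2, 1), [0, 67]), (Some (1, 0), [85]), (Some (0, 0), [12, 12, 43]),
     (Some (0, 0), [33, 40]), (Some (1, 0), [51, 19]), (Some (0, 0), [51, 19]), (Some (0, 0), [12,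
     12, 16, 29]), (Some (1, 0), [12, 12, 43]), (Some (0, 0), [85])]),
  ([(2, 0, 1), (3, 2, 2), (7, 0, 1)], -14, [(Some (1, 0), [21, 58]), (Some (3, 2), [22, 11, 28]),
     (Some (1, 0), [79]), (Some (2, 1), [0, 10, 58]), (Some (0, 0), [79]), (Some (1, 2), [51,
     19]), (Some (1, 0), [22, 12, 29]), (Some (0, 1), [0, 70]), (Some (1, 2), [51, 19]), (Some (0,
     2), [22, 11, 12, 15]), (Some (0, 4), [17, 55]), (Some (3, 1), [0, 72])]),
  ([(2, 0, 1), (4, 1, 2), (6, 0, 2)], -14, [(Some (2, 0), [50, 19]), (Some (2, 0), [47, 19]),
     (Some (2, 1), [0, 72]), (Some (1, 0), [47, 17]), (Some (3, 2), [26, 11, 12, 15]), (Some (0,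
     2), [85]), (Some (1, 0), [12, 29, 30]), (Some (1, 0), [46, 19]), (Some (0, 1), [0, 70]),
     (Some (0, 1), [0, 46, 16]), (Some (1, 0), [12, 29, 30]), (Some (0, 4), [86])]),
  ([(2, 0, 1), (10, 0, 1)], -10, [(Some (1, 0), [90]), (Some (2, 9), [81]), (Some (1, 2), [85]),
     (Some (1, 7), [79]), (Some (0, 1), [0, 71]), (Some (1, 5), [52, 19]), (Some (1, 0), [12, 29,
     29]), (Some (0, 4), [86]), (Some (1, 2), [85]), (Some (0, 2), [11, 12, 15, 29]), (Some (0,
     7), [17, 57]), (Some (2, 1), [0, 75])]),
  ([(3, 2, 2), (4, 0, 1), (5, 0, 1)], -14, [(Some (1, 0), [80]), (Some (2, 1), [0, 10, 52]), (Some
     (0, 0), [80]), (Some (1, 2), [52, 21]), (Some (3, 2), [22, 11, 12, 15]), (Some (0, 1), [0,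
     68]), (Some (3, 4), [19, 55]), (Some (1, 0), [19, 56]), (Some (1, 2), [22, 12, 28]), (Some
     (0, 1), [0, 15, 56]), (Some (0, 2), [25, 11, 28]), (Some (0, 2), [22, 11, 28])]),
  ([(3, 2, 2), (9, 0, 0)], -12, [(Some (1, 0), [81]), (Some (2, 1), [0, 10, 57]), (Some (0, 0),
     [81]), (Some (1, 1), [0, 72]), (Some (1, 2), [22, 11, 29]), (Some (0, 1), [0, 72]), (Some (1,
     4), [19, 55]), (Some (0, 2), [22, 11, 29]), (Some (0, 4), [19, 55]), (Some (1, 1), [0, 72]),
     (Some (0, 2), [22, 11, 29]), (Some (0, 1), [0, 72])]),
  ([(4, 0, 0), (4, 1, 2), (4, 1, 2)], -14, [(Some (1, 1), [0, 66]), (Some (1, 1), [0, 66]), (Some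
     (0, 1), [0, 66]), (Some (0, 1), [0, 66]), (Some (3, 0), [19, 55]), (Some (0, 0), [16, 27,
     30]), (Some (1, 0), [15, 27, 30]), (Some (0, 2), [86]), (Some (2, 0), [19, 55]), (Some (0,
     0), [16, 27, 30]), (Some (1, 0), [15, 27, 30]), (Some (0, 2), [86])]),
  ([(4, 0, 0), (8, 2, 2)], -12, [(Some (1, 1), [0, 67]), (Some (1, 1), [0, 67]), (Some (0, 1), [0,
     67]), (Some (0, 1), [0, 67]), (Some (1, 0), [87]), (Some (0, 0), [27, 43]), (Some (0, 0),
     [34, 40]), (Some (1, 0), [19, 55]), (Some (0, 0), [19, 55]), (Some (0, 0), [16, 27, 29]),
     (Some (1, 0), [27, 43]), (Some (0, 0), [87])]),
  ([(4, 0, 1), (8, 0, 1)], -10, [(Some (1, 1), [78]), (Some (1, 1), [78]), (Some (0, 1), [0, 69]),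
     (Some (2, 7), [19, 57]), (Some (1, 0), [88]), (Some (1, 5), [80]), (Some (0, 1), [0, 73]),
     (Some (0, 2), [11, 28, 30]), (Some (1, 2), [12, 28, 29]), (Some (0, 4), [15, 63]), (Some (1,
     0), [88]), (Some (0, 2), [11, 28, 29])]),
  ([(5, 0, 1), (7, 0, 1)], -10, [(Some (1, 0), [19, 58]), (Some (1, 2), [79]), (Some (0, 1), [0,
     15, 58]), (Some (1, 0), [19, 58]), (Some (2, 2), [11, 28, 29]), (Some (1, 0), [89]), (Some
     (1, 4), [80]), (Some (0, 1), [0, 74]), (Some (1, 2), [52, 19]), (Some (2, 2), [11, 12, 15,
     29]), (Some (1, 0), [89]), (Some (2, 4), [87])]),
  ([(5, 0, 1), (7, 1, 2)], -14, [(None, [93]), (Some (1, 2), [2, 71]), (Some (0, 1), [0, 15, 60]),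
     (Some (0, 1), [0, 65]), (Some (2, 2), [12, 29, 29]), (Some (1, 0), [89]), (Some (0, 0), [38,
     40]), (Some (1, 0), [15, 19, 38]), (Some (0, 2), [52, 21]), (None, [16, 74]), (Some (0, 2),
     [18, 52]), (Some (0, 0), [89])]),
  ([(5, 0, 2), (7, 1, 2)], -14, [(Some (1, 0), [19, 60]), (Some (2, 2), [22, 12, 29]), (Some (0,
     1), [0, 16, 60]), (Some (1, 0), [19, 60]), (Some (2, 2), [12, 29, 29]), (Some (2, 0), [29,
     43]), (Some (2, 4), [36, 40]), (Some (1, 0), [53, 19]), (Some (2, 4), [20, 55]), (Some (2,
     0), [16, 29, 30]), (Some (2, 4), [84]), (Some (0, 5), [89])]),
  ([(6, 0, 2), (6, 0, 2)], -12, [(Some (1, 1), [47, 19]), (Some (1, 0), [47, 19]), (Some (0, 1),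
     [0, 72]), (Some (0, 1), [0, 47, 16]), (Some (2, 2), [26, 11, 29]), (Some (0, 4), [87]), (Some
     (1, 1), [47, 19]), (Some (1, 0), [47, 19]), (Some (0, 1), [0, 72]), (Some (0, 1), [0, 47,
     16]), (Some (2, 2), [26, 11, 29]), (Some (0, 4), [87])]),
  ([(12, 0, 0)], -8, [(Some (1, 1), [0, 75]), (Some (1, 9), [81]), (Some (0, 1), [0, 75]), (Some
     (1, 7), [19, 57]), (Some (1, 2), [11, 29, 29]), (Some (0, 4), [87]), (Some (1, 4), [87]),
     (Some (0, 2), [11, 29, 29]), (Some (0, 7), [19, 57]), (Some (1, 1), [0, 75]), (Some (0, 9),
     [81]), (Some (0, 1), [0, 75])]),
  ([(12, 0, 1)], -10, [(Some (1, 1), [1, 75]), (Some (1, 9), [82]), (Some (0, 1), [0, 76]), (Some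
     (0, 2), [11, 64]), (Some (1, 2), [12, 29, 29]), (Some (1, 5), [89]), (Some (1, 4), [88]),
     (Some (0, 2), [11, 29, 30]), (Some (0, 7), [20, 57]), (Some (1, 1), [1, 75]), (Some (0, 9),
     [83]), (Some (0, 1), [0, 75])]),
  ([(12, 0, 2)], -12, [(None, [94]), (Some (1, 0), [2, 75]), (Some (0, 1), [0, 77]), (Some (0, 1),
     [0, 67]), (Some (1, 2), [13, 29, 29]), (Some (0, 0), [29, 43]), (Some (0, 1), [0, 29, 40]),
     (Some (0, 2), [11, 29, 31]), (Some (0, 1), [0, 72]), (None, [16, 75]), (Some (0, 7), [18,
     57]), (Some (0, 1), [0, 75])]),
  ([(1, 1, 2), (13, 0, 1)], -14, [(Some (2, 12), [115]), (Some (1, 2), [17, 75]), (Some (2, 0),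
     [99]), (Some (0, 1), [0, 92]), (Some (1, 8), [69, 19]), (Some (1, 3), [23, 29, 29]), (Some
     (2, 0), [113]), (Some (1, 5), [101]), (Some (0, 2), [41, 11, 29]), (Some (0, 7), [37, 57]),
     (Some (1, 2), [17, 75]), (Some (0, 9), [83, 15]), (Some (0, 1), [0, 8, 75]), (Some (2, 0),
     [117])]),
  ([(2, 0, 1), (12, 1, 2)], -14, [(Some (2, 2), [17, 75]), (Some (2, 0), [98]), (Some (2, 1), [0,
     94]), (Some (1, 0), [17, 75]), (Some (1, 4), [12, 15, 29, 29]), (Some (0, 2), [102]), (Some
     (1, 0), [104]), (Some (0, 0), [12, 29, 43]), (Some (0, 5), [52, 40]), (Some (1, 0), [71,
     19]), (Some (0, 7), [103]), (Some (0, 2), [85, 16]), (Some (1, 0), [12, 91]), (Some (0, 10),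
     [105])]),
  ([(4, 0, 1), (10, 1, 2)], -14, [(Some (1, 2), [12, 91]), (Some (2, 9), [82, 15]), (Some (0, 1),
     [0, 92]), (Some (0, 2), [11, 91]), (Some (1, 4), [28, 29, 29]), (Some (1, 0), [100]), (Some
     (1, 0), [15, 88]), (Some (0, 2), [12, 28, 43]), (Some (0, 3), [54, 40]), (Some (1, 0), [19,
     73]), (Some (0, 5), [106]), (Some (0, 0), [16, 88]), (Some (1, 0), [28, 64]), (Some (0, 8),
     [110])]),
  ([(4, 1, 2), (10, 0, 1)], -14, [(Some (2, 9), [107]), (Some (0, 0), [16, 90]), (Some (1, 0),
     [15, 90]), (Some (0, 2), [105]), (Some (1, 2), [104]), (Some (1, 7), [97]), (Some (0, 1), [0,
     93]), (Some (1, 5), [19, 74]), (Some (1, 0), [29, 29, 30]), (Some (0, 4), [108]), (Some (1,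
     2), [104]), (Some (0, 2), [11, 15, 29, 30]), (Some (0, 7), [37, 57]), (Some (2, 0), [19,
     75])]),
  ([(5, 0, 1), (9, 1, 2)], -14, [(Some (1, 0), [19, 76]), (Some (1, 2), [95]), (Some (0, 1), [0,
     15, 76]), (Some (1, 0), [19, 76]), (Some (2, 4), [28, 29, 29]), (Some (2, 4), [109]), (Some
     (1, 0), [101]), (Some (1, 0), [15, 89]), (Some (0, 2), [52, 40]), (Some (1, 0), [19, 74]),
     (Some (0, 4), [106]), (Some (0, 0), [16, 89]), (Some (1, 0), [112]), (Some (0, 7), [111])]),
  ([(7, 0, 1), (7, 1, 2)], -14, [(Some (1, 0), [113]), (Some (1, 4), [96]), (Some (0, 1), [0,
     93]), (Some (1, 2), [71, 19]), (Some (2, 2), [12, 15, 29, 29]), (Some (1, 0), [113]), (Some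
     (2, 0), [114]), (Some (2, 2), [11, 28, 43]), (Some (0, 0), [40, 58]), (Some (1, 0), [15, 19,
     58]), (Some (0, 2), [103]), (Some (0, 0), [16, 19, 58]), (Some (1, 0), [39, 58]), (Some (0,
     5), [111])]),
  ([(14, 0, 2)], -12, [(Some (1, 0), [117]), (Some (1, 0), [98]), (Some (0, 1), [0, 94]), (Some
     (1, 0), [19, 75]), (Some (1, 4), [29, 29, 29]), (Some (0, 4), [109]), (Some (1, 0), [114]),
     (Some (0, 2), [11, 29, 43]), (Some (0, 7), [40, 57]), (Some (1, 0), [19, 75]), (Some (0, 9),
     [107]), (Some (0, 1), [0, 16, 75]), (Some (1, 0), [117]), (Some (0, 12), [115])]),
  ([(16, 1, 1)], -14, [(Some (1, 0), [124]), (Some (1, 13), [118]), (Some (1, 12), [15, 116]),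
     (Some (0, 2), [119]), (Some (1, 10), [121]), (Some (0, 4), [120]), (Some (0, 5), [122]),
     (Some (1, 7), [123]), (Some (0, 7), [123]), (Some (1, 5), [122]), (Some (1, 4), [120]), (Some
     (0, 10), [121]), (Some (1, 2), [119]), (Some (0, 12), [15, 116]), (Some (0, 13), [118]),
     (Some (0, 0), [124])])]"

lemma check_breaker_table:
  "list_all (check_entry 2 0 (- 1) (bounds breaker_table)) breaker_table"
  by code_simp

lemma breaker_base:
  "secures 2 0 (- 1) {#(2, 1, 1)#} (- 2)" "secures 2 0 (- 1) {#(16, 1, 1)#} (- 14)"
proof -
  have "list_all (\<lambda>e. e \<in> set (bounds breaker_table)) [([(2, 1, 1)], - 2), ([(16, 1, 1)], - 14)]"
    by code_simp
  with check_sound[OF check_breaker_table]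
  have "secures 2 0 (- 1) (mset [(2, 1, 1)]) (- 2)" "secures 2 0 (- 1) (mset [(16, 1, 1)]) (- 14)"
    by (simp_all only: list.pred_inject simp_thms)
  then show "secures 2 0 (- 1) {#(2, 1, 1)#} (- 2)" "secures 2 0 (- 1) {#(16, 1, 1)#} (- 14)"
    by simp_all
qed

section \<open>From labelings to segments\<close>

definition lw :: "nat \<Rightarrow> nat" where
  "lw x = (if x = 0 then 2 else 0)"

text \<open>Reads off the segments, where the current one has left weight \<open>a\<close> and already \<open>k\<close> cells.\<close>

fun scan :: "nat \<Rightarrow> nat \<Rightarrow> nat option list \<Rightarrow> seg list" where
  "scan a k [] = [(k, a, 1)]"
| "scan a k (None # w) = scan a (Suc k) w"
| "scan a k (Some x # w) = (k, a, lw x) # scan (lw x) 0 w"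

lemma scan_replicate: "scan a k (replicate m None @ w) = scan a (k + m) w"
  by (induction m arbitrary: k) auto

text \<open>The accumulators affect only the first segment, and there only its length and left
  weight. Hence a label put into the current run splits that segment and leaves all later ones
  alone.\<close>

lemma scan_head: "\<exists>k' b X. \<forall>a k. scan a k w = (k + k', a, b) # X"
proof (induction w)
  case (Cons z w)
  then obtain k' b X where *: "\<And>a k. scan a k w = (k + k', a, b) # X" by blast
  show ?case
  proof (cases z)
    case None
    then show ?thesis by (auto simp: * intro!: exI[of _ "Suc k'"])
  qed auto
qed auto

text \<open>Segment and cell are chosen before the label \<open>x\<close>. This order of quantifiers
  later permits comparing the labels 0 and 1 at the same vertex.\<close>

lemma scan_update:
  assumes "i < length w" "w ! i = None"
  shows "\<exists>k' a' b j X. j < k' \<and> mset (scan a k w) = add_mset (k', a', b) X \<and>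
    (\<forall>x. mset (scan a k (w[i := Some x])) =
      add_mset (j, a', lw x) (add_mset (k' - 1 - j, lw x, b) X))"
  using assms
proof (induction w arbitrary: a k i)
  case (Cons z w)
  show ?case
  proof (cases i)
    case 0
    with Cons.prems have z: "z = None" by simp
    from scan_head[of w] obtain k' b X where *: "\<And>a k. scan a k w = (k + k', a, b) # X"
      by blast
    show ?thesis
      by (rule exI[of _ "Suc k + k'"], rule exI[of _ a], rule exI[of _ b], rule exI[of _ k],
          rule exI[of _ "mset X"]) (simp add: 0 z *)
  next
    case (Suc i')
    with Cons.prems have i': "i' < length w" "w ! i' = None" by auto
    show ?thesis
    proof (cases z)
      case None
      then show ?thesis using Cons.IH[OF i', of a "Suc k"] by (simp add: Suc)
    next
      case (Some y)
      from Cons.IH[OF i', of "lw y" 0] obtain k' a' b j X where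
        "j < k'" "mset (scan (lw y) 0 w) = add_mset (k', a', b) X"
        "\<And>x. mset (scan (lw y) 0 (w[i' := Some x])) =
          add_mset (j, a', lw x) (add_mset (k' - 1 - j, lw x, b) X)" by blast
      then show ?thesis
        by (intro exI[of _ k'] exI[of _ a'] exI[of _ b] exI[of _ j] exI[of _ "add_mset (k, a, lw y) X"])
          (simp add: Suc Some add_mset_commute)
    qed
  qed
qed simp

lemma update_conv_scan_replicate:
  assumes "j < k"
  shows "mset (scan a 0 ((replicate k None @ w)[j := Some x])) =
    add_mset (j, a, lw x) (mset (scan (lw x) (k - 1 - j) w))"
proof -
  have "replicate k None = replicate j None @ None # replicate (k - 1 - j) None"
    using assms by (metis Suc_diff_Suc diff_Suc_eq_diff_pred le_add_diff_inverse less_imp_le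
        replicate_Suc replicate_add)
  then have "replicate k None @ w = replicate j None @ None # replicate (k - 1 - j) None @ w"
    by (metis append_Cons append_assoc)
  then have "(replicate k None @ w)[j := Some x] =
      replicate j None @ Some x # replicate (k - 1 - j) None @ w"
    using list_update_length[of "replicate j None" None "replicate (k - 1 - j) None @ w" "Some x"]
    by (simp only: length_replicate)
  then show ?thesis by (simp add: scan_replicate)
qed

text \<open>The converse direction: every cell of every segment is a vertex. The pending cells are
  kept as a prefix of the list and not in the accumulator of \<open>scan\<close>, because the vertex
  sought may be one of them.\<close>

lemma update_scan_replicate:
  assumes "mset (scan a 0 (replicate k None @ w)) = add_mset (k', a', b) X" "j < k'"
  shows "\<exists>i<k + length w. (replicate k None @ w) ! i = None \<and>
    (\<forall>x. mset (scan a 0 ((replicate k None @ w)[i := Some x])) =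
      add_mset (j, a', lw x) (add_mset (k' - 1 - j, lw x, b) X))"
  using assms
proof (induction w arbitrary: a k X)
  case Nil
  then have [simp]: "k' = k" "a' = a" "b = 1" "X = {#}"
    using scan_replicate[of a 0 k "[]"] by auto
  show ?case using Nil.prems(2) update_conv_scan_replicate[of j k a "[]"]
    by (intro exI[of _ j]) (auto simp: nth_append)
next
  case (Cons z w)
  show ?case
  proof (cases z)
    case None
    have *: "replicate k None @ z # w = replicate (Suc k) None @ w"
      by (simp add: None replicate_app_Cons_same)
    show ?thesis using Cons.IH[of a "Suc k" X] Cons.prems unfolding * by simp
  next
    case (Some y)
    have "add_mset (k, a, lw y) (mset (scan (lw y) 0 w)) = add_mset (k', a', b) X"
      using Cons.prems by (simp add: Some scan_replicate)
    then consider "(k', a', b) = (k, a, lw y)" "X = mset (scan (lw y) 0 w)"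
      | X' where "mset (scan (lw y) 0 w) = add_mset (k', a', b) X'" "X = add_mset (k, a, lw y) X'"
      unfolding add_eq_conv_ex by auto
    then show ?thesis
    proof cases
      case 1
      then show ?thesis using Cons.prems(2) update_conv_scan_replicate[of j k a "z # w"]
        by (intro exI[of _ j]) (auto simp: nth_append Some)
    next
      case 2
      from Cons.IH[of "lw y" 0 X'] 2(1) Cons.prems(2) obtain i where i: "i < length w" "w ! i = None"
        "\<And>x. mset (scan (lw y) 0 (w[i := Some x])) =
          add_mset (j, a', lw x) (add_mset (k' - 1 - j, lw x, b) X')"
        by auto
      then show ?thesis using 2(2)
        by (intro exI[of _ "k + Suc i"])
          (auto simp: nth_append Some list_update_append scan_replicate add_mset_commute)
    qed
  qed
qed

definition pos :: "nat \<Rightarrow> nat labeling \<Rightarrow> seg multiset" where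
  "pos n L = mset (scan 1 0 (map L [1..<Suc n]))"

lemma map_update:
  assumes "v \<in> {1..n}"
  shows "map (L(v \<mapsto> x)) [1..<Suc n] = (map L [1..<Suc n])[v - 1 := Some x]"
  by (rule nth_equalityI) (use assms in \<open>auto simp: nth_list_update simp del: upt_Suc\<close>)

definition lstep :: "'a set \<Rightarrow> nat \<Rightarrow> 'a labeling \<Rightarrow> 'a labeling \<Rightarrow> bool" where
  "lstep V x L L' \<longleftrightarrow> (\<exists>v\<in>V. L v = None \<and> L' = L(v \<mapsto> x))"

lemma lstepI: "v \<in> V \<Longrightarrow> L v = None \<Longrightarrow> lstep V x L (L(v \<mapsto> x))"
  unfolding lstep_def by blast

lemma no_lstep: "(\<forall>L'. \<not> lstep V x L L') \<longleftrightarrow> V \<subseteq> dom L"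
  unfolding lstep_def by auto

lemma pos_update:
  assumes "v \<in> {1..n}" "L v = None"
  obtains k a b j X where "j < k" "pos n L = add_mset (k, a, b) X"
    "\<And>x. pos n (L(v \<mapsto> x)) = add_mset (j, a, lw x) (add_mset (k - 1 - j, lw x, b) X)"
proof -
  have "v - 1 < length (map L [1..<Suc n])" "map L [1..<Suc n] ! (v - 1) = None"
    using assms by (auto simp del: upt_Suc)
  from scan_update[OF this, of 1 0] show thesis
    using that unfolding pos_def map_update[OF assms(1)] by blast
qed

lemma step_pos:
  assumes "step (lw x) (pos n L) Y"
  shows "\<exists>v\<in>{1..n}. L v = None \<and> Y = pos n (L(v \<mapsto> x))"
proof -
  from assms obtain k a b j X where X: "pos n L = add_mset (k, a, b) X" "j < k"
    "Y = add_mset (j, a, lw x) (add_mset (k - 1 - j, lw x, b) X)" by (rule stepE)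
  from update_scan_replicate[of 1 0 "map L [1..<Suc n]" k a b X j] X obtain i where
    i: "i < n" "map L [1..<Suc n] ! i = None"
    "mset (scan 1 0 ((map L [1..<Suc n])[i := Some x])) = Y"
    by (auto simp: pos_def simp del: upt_Suc)
  have "Suc i \<in> {1..n}" "L (Suc i) = None" using i(1,2) by (auto simp del: upt_Suc)
  moreover have "Y = pos n (L(Suc i \<mapsto> x))"
    using i(3) \<open>Suc i \<in> {1..n}\<close> unfolding pos_def by (subst map_update) auto
  ultimately show ?thesis by blast
qed

text \<open>Labelling a vertex splits a segment at a cell, and every such split comes from a vertex,
  so \<open>pos n\<close> matches the moves of both games in both directions.\<close>

lemma resp_labelings:
  assumes "secures (lw p) (lw q) \<sigma> (pos n L) c"
  shows "resp (lstep {1..n} p) (lstep {1..n} q) (\<lambda>L. c \<le> \<sigma> * score (pos n L)) L"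
  using assms unfolding secures_def
proof (rule resp_transfer[where R = "\<lambda>L X. X = pos n L"], goal_cases)
  case (2 L X L')
  then obtain v where v: "v \<in> {1..n}" "L v = None" "L' = L(v \<mapsto> p)"
    by (auto simp: lstep_def)
  from pos_update[of v n L, OF v(1,2)] obtain k a b j X' where X': "j < k" "pos n L = add_mset (k, a, b) X'"
    "\<And>x. pos n (L(v \<mapsto> x)) = add_mset (j, a, lw x) (add_mset (k - 1 - j, lw x, b) X')" by metis
  have "step (lw p) (pos n L) (pos n L')" unfolding v(3) X'(2,3) by (rule stepI[OF X'(1)])
  then show ?case using 2(1) by blast
next
  case (3 L X X')
  then show ?case using step_pos[of q n L X'] by (auto intro: lstepI)
next
  case (4 L X X')
  then show ?case using step_pos[of p n L X'] by (auto intro: lstepI)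
qed auto

text \<open>Both labels fall into the same cell, where weight w adds w * (a + b) to a fixed amount.
  This is nondecreasing in w, and a 0 has the larger weight.\<close>

lemma score_pos_mono:
  assumes "v \<in> {1..n}" "L v = None"
  shows "score (pos n (L(v \<mapsto> 1))) \<le> score (pos n (L(v \<mapsto> 0)))"
  using assms by (rule pos_update) (auto simp: lw_def)

text \<open>An additional move never hurts the responder, so the passes granted by \<^const>\<open>resp\<close> can be
  filled with arbitrary moves.\<close>

lemma resp_extra_move:
  assumes "resp (lstep V p) (lstep V q) Q L" "u \<in> V" "L u = None"
    and mono: "\<And>L u. u \<in> V \<Longrightarrow> L u = None \<Longrightarrow> Q (L(u \<mapsto> p)) \<Longrightarrow> Q (L(u \<mapsto> q))"
  shows "resp (lstep V p) (lstep V q) Q (L(u \<mapsto> q))"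
  using assms(1-3)
proof (induction rule: resp.induct)
  case (respI L)
  show ?case
  proof (rule resp.respI)
    fix L' assume "lstep V p (L(u \<mapsto> q)) L'"
    then obtain v where "v \<in> V" "(L(u \<mapsto> q)) v = None" "L' = L(u \<mapsto> q, v \<mapsto> p)"
      unfolding lstep_def by blast
    then have v: "v \<in> V" "v \<noteq> u" "L v = None" "L' = L(u \<mapsto> q, v \<mapsto> p)"
      by (simp_all split: if_splits)
    have L': "L' = L(v \<mapsto> p, u \<mapsto> q)"
      unfolding v(4) by (rule fun_upd_twist) (use v(2) in simp)
    from respI.IH[OF lstepI[of v V L p, OF v(1,3)]]
    show "resp (lstep V p) (lstep V q) Q L' \<or>
        (\<exists>L''. lstep V q L' L'' \<and> resp (lstep V p) (lstep V q) Q L'')"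
    proof (elim disjE exE conjE)
      assume "u \<in> V \<longrightarrow> (L(v \<mapsto> p)) u = None \<longrightarrow> resp (lstep V p) (lstep V q) Q (L(v \<mapsto> p, u \<mapsto> q))"
      then show ?thesis using respI.prems v(2) L' by simp
    next
      fix M assume M: "lstep V q (L(v \<mapsto> p)) M" "resp (lstep V p) (lstep V q) Q M"
        "u \<in> V \<longrightarrow> M u = None \<longrightarrow> resp (lstep V p) (lstep V q) Q (M(u \<mapsto> q))"
      from M(1) obtain w where "w \<in> V" "(L(v \<mapsto> p)) w = None" "M = L(v \<mapsto> p, w \<mapsto> q)"
        unfolding lstep_def by blast
      then have w: "w \<in> V" "w \<noteq> v" "L w = None" "M = L(v \<mapsto> p, w \<mapsto> q)"
        by (simp_all split: if_splits)
      show ?thesis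
      proof (cases "w = u")
        \<comment> \<open>The prescribed reply is the surplus vertex itself. The position after that
          reply is already reached, so the responder passes.\<close>
        case True
        then have "M = L'" unfolding L' w(4) by simp
        with M(2) show ?thesis by blast
      next
        case False
        have "L' w = None" unfolding L' using False w(2,3) by simp
        then have "lstep V q L' (L'(w \<mapsto> q))" by (rule lstepI[OF w(1)])
        moreover have "L'(w \<mapsto> q) = M(u \<mapsto> q)"
          unfolding L' w(4) by (rule fun_upd_twist) (use False in simp)
        moreover have "M u = None" unfolding w(4) using False v(2) respI.prems by simp
        ultimately show ?thesis using M(3) respI.prems by metis
      qed
    qed
  next
    \<comment> \<open>Only \<open>u\<close> was free in \<open>L\<close>. Had the opponent labelled
      it, the original strategy would have ended in \<open>Q\<close>, and by \<open>mono\<close> the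
      responder's label on \<open>u\<close> is at least as good.\<close>
    assume stuck: "\<And>L'. \<not> lstep V p (L(u \<mapsto> q)) L'"
    then have "V \<subseteq> dom (L(u \<mapsto> q))" using no_lstep[of V p "L(u \<mapsto> q)"] by blast
    then have "V \<subseteq> dom (L(u \<mapsto> p))" by auto
    then have no: "\<And>x L'. \<not> lstep V x (L(u \<mapsto> p)) L'" using no_lstep by blast
    with respI.IH[OF lstepI[of u V L p, OF respI.prems]]
    have "resp (lstep V p) (lstep V q) Q (L(u \<mapsto> p))" by metis
    then have "Q (L(u \<mapsto> p))" by (rule resp_terminal) (rule no)
    then show "Q (L(u \<mapsto> q))" using mono respI.prems by blast
  qed
qed

section \<open>From strategies to game values\<close>

definition zeros :: "'a set \<Rightarrow> 'a labeling \<Rightarrow> nat" where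
  "zeros V L = card {v \<in> V. L v = Some 0}"

lemma zeros_upd0: "finite V \<Longrightarrow> v \<in> V \<Longrightarrow> L v = None \<Longrightarrow> zeros V (L(v \<mapsto> 0)) = Suc (zeros V L)"
proof -
  assume *: "finite V" "v \<in> V" "L v = None"
  then have "{u \<in> V. (L(v \<mapsto> 0)) u = Some 0} = insert v {u \<in> V. L u = Some 0}" by auto
  with * show ?thesis by (simp add: zeros_def)
qed

lemma zeros_upd1: "L v = None \<Longrightarrow> zeros V (L(v \<mapsto> 1)) = zeros V L"
  unfolding zeros_def by (rule arg_cong[of _ _ card]) auto

lemma card_free_upd: "finite V \<Longrightarrow> v \<in> V \<Longrightarrow> L v = None \<Longrightarrow>
    card (V - dom L) = Suc (card (V - dom (L(v \<mapsto> x))))"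
proof -
  assume *: "finite V" "v \<in> V" "L v = None"
  then have eq: "V - dom L = insert v (V - dom (L(v \<mapsto> x)))" by auto
  show ?thesis unfolding eq by (rule card_insert_disjoint) (use * in auto)
qed

text \<open>The balance game knows no pass, so a pass is turned into a move at any free vertex. Only
  when the opponent has labelled the last vertex is no reply due; that case is
  \<open>resp_full\<close>.\<close>

lemma resp_reply:
  assumes "resp (lstep V p) (lstep V q) Q L" "v \<in> V" "L v = None"
    and mono: "\<And>L u. u \<in> V \<Longrightarrow> L u = None \<Longrightarrow> Q (L(u \<mapsto> p)) \<Longrightarrow> Q (L(u \<mapsto> q))"
    and free: "\<not> V \<subseteq> dom (L(v \<mapsto> p))"
  obtains u where "u \<in> V" "(L(v \<mapsto> p)) u = None" "resp (lstep V p) (lstep V q) Q (L(v \<mapsto> p, u \<mapsto> q))"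
proof -
  from resp_step[OF assms(1), OF lstepI[of v V L p, OF assms(2,3)]] show thesis
  proof (elim disjE exE conjE)
    assume *: "resp (lstep V p) (lstep V q) Q (L(v \<mapsto> p))"
    from free obtain u where "u \<in> V" "(L(v \<mapsto> p)) u = None" by blast
    with resp_extra_move[OF * this mono] that show thesis by blast
  qed (use that in \<open>auto simp: lstep_def\<close>)
qed

lemma resp_full:
  assumes "resp (lstep V p) (lstep V q) Q L" "v \<in> V" "L v = None" "V \<subseteq> dom (L(v \<mapsto> p))"
  shows "Q (L(v \<mapsto> p))"
proof -
  have no: "\<And>x L'. \<not> lstep V x (L(v \<mapsto> p)) L'" using assms(4) no_lstep by blast
  with resp_step[OF assms(1), OF lstepI[of v V L p, OF assms(2,3)]]
  have "resp (lstep V p) (lstep V q) Q (L(v \<mapsto> p))" by blast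
  then show ?thesis by (rule resp_terminal) (rule no)
qed

lemma game_value_Admirable_le:
  assumes "finite (verts G)" "u \<in> verts G" "L u = None"
  shows "game_value G Admirable L \<le> game_value G Impish (L(u \<mapsto> 0))"
proof -
  have u: "u \<in> verts G - dom L" using assms by auto
  then show ?thesis using assms(1)
    by (subst game_value.simps) (simp add: ex_in_conv[symmetric], blast intro: Min_le)
qed

lemma game_value_Impish_ge:
  assumes "finite (verts G)" "u \<in> verts G" "L u = None"
  shows "game_value G Admirable (L(u \<mapsto> 1)) \<le> game_value G Impish L"
proof -
  have u: "u \<in> verts G - dom L" using assms by auto
  then show ?thesis using assms(1)
    by (subst (2) game_value.simps) (simp add: ex_in_conv[symmetric], blast intro: Max_ge)
qed

text \<open>\<open>N\<close> is the number of zeros at the end: with Impish to move, Admirable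
  labels half of the free vertices, rounded down. The sum in the last premise is invariant under a
  pair of moves, and knowing \<open>N\<close> is what lets \<open>final\<close> turn a bound on S
  into one on the discrepancy.\<close>

lemma game_value_le:
  assumes "finite (verts G)"
    and mono: "\<And>L u. u \<in> verts G \<Longrightarrow> L u = None \<Longrightarrow> Q (L(u \<mapsto> 1)) \<Longrightarrow> Q (L(u \<mapsto> 0))"
    and final: "\<And>L. \<forall>v\<in>verts G. L v \<in> {Some 0, Some 1} \<Longrightarrow> zeros (verts G) L = N \<Longrightarrow> Q L \<Longrightarrow>
      discrepancy G L \<le> D"
    and "resp (lstep (verts G) 1) (lstep (verts G) 0) Q L"
    and "ran L \<subseteq> {0, 1}" "zeros (verts G) L + card (verts G - dom L) div 2 = N"
  shows "game_value G Impish L \<le> D"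
  using assms(4-)
proof (induction "card (verts G - dom L)" arbitrary: L rule: less_induct)
  case (less L)
  let ?V = "verts G"
  have full_le: "discrepancy G M \<le> D"
    if "?V \<subseteq> dom M" "ran M \<subseteq> {0, 1}" "zeros ?V M = N" "Q M" for M
  proof (rule final[OF _ that(3,4)])
    show "\<forall>v\<in>?V. M v \<in> {Some 0, Some 1}" using that(1,2) by (fastforce simp: ran_def)
  qed
  show ?case
  proof (cases "?V \<subseteq> dom L")
    case True
    have "Q L" by (rule resp_terminal[OF less.prems(1)]) (use True no_lstep in blast)
    moreover have empty: "?V - dom L = {}" using True by auto
    with less.prems(3) have "zeros ?V L = N" by simp
    ultimately show ?thesis
      using full_le[OF True less.prems(2)] empty by (subst game_value.simps) simp
  next
    case False
    \<comment> \<open>One induction step consists of Impish's move \<open>v\<close> and Admirable's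
      answer \<open>u\<close>. There is no answer exactly when \<open>v\<close> was the only free
      vertex.\<close>
    have "game_value G Admirable (L(v \<mapsto> 1)) \<le> D" if "v \<in> ?V - dom L" for v
    proof -
      have v: "v \<in> ?V" "L v = None" using that by auto
      let ?L = "L(v \<mapsto> 1)"
      have ran: "ran ?L \<subseteq> {0, 1}" using less.prems(2) v(2) by auto
      note card = card_free_upd[of ?V v L 1, OF assms(1) v]
      show ?thesis
      proof (cases "?V \<subseteq> dom ?L")
        case True
        have empty: "?V - dom ?L = {}" using True by auto
        with card have "card (?V - dom L) = 1" by (simp only: card.empty)
        with less.prems(3) zeros_upd1[of L v ?V] v(2) have "zeros ?V ?L = N" by simp
        from full_le[OF True ran this resp_full[OF less.prems(1) v True]] show ?thesis
          using empty by (subst game_value.simps) simp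
      next
        case False
        from resp_reply[OF less.prems(1) v mono False] obtain u where
          u: "u \<in> ?V" "?L u = None" "resp (lstep ?V 1) (lstep ?V 0) Q (?L(u \<mapsto> 0))" by blast
        note card' = card_free_upd[of ?V u ?L 0, OF assms(1) u(1,2)]
        have "game_value G Impish (?L(u \<mapsto> 0)) \<le> D"
        proof (rule less.hyps[OF _ u(3)])
          show "ran (?L(u \<mapsto> 0)) \<subseteq> {0, 1}" using ran u(2) by auto
          show "zeros ?V (?L(u \<mapsto> 0)) + card (?V - dom (?L(u \<mapsto> 0))) div 2 = N"
            using less.prems(3) card card' zeros_upd0[of ?V u ?L, OF assms(1) u(1,2)] zeros_upd1[of L v ?V] v(2)
            by simp
        qed (use card card' in linarith)
        moreover have "game_value G Admirable ?L \<le> game_value G Impish (?L(u \<mapsto> 0))"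
          using assms(1) u(1,2) by (rule game_value_Admirable_le)
        ultimately show ?thesis by linarith
      qed
    qed
    moreover have "?V - dom L \<noteq> {}" using False by auto
    ultimately show ?thesis using assms(1) by (subst game_value.simps) simp
  qed
qed

text \<open>The mirror image, with Admirable to move: she labels half of the free vertices rounded
  up, whence the \<open>Suc\<close>.\<close>

lemma game_value_ge:
  assumes "finite (verts G)"
    and mono: "\<And>L u. u \<in> verts G \<Longrightarrow> L u = None \<Longrightarrow> Q (L(u \<mapsto> 0)) \<Longrightarrow> Q (L(u \<mapsto> 1))"
    and final: "\<And>L. \<forall>v\<in>verts G. L v \<in> {Some 0, Some 1} \<Longrightarrow> zeros (verts G) L = N \<Longrightarrow> Q L \<Longrightarrow>
      D \<le> discrepancy G L"
    and "resp (lstep (verts G) 0) (lstep (verts G) 1) Q L"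
    and "ran L \<subseteq> {0, 1}" "zeros (verts G) L + Suc (card (verts G - dom L)) div 2 = N"
  shows "D \<le> game_value G Admirable L"
  using assms(4-)
proof (induction "card (verts G - dom L)" arbitrary: L rule: less_induct)
  case (less L)
  let ?V = "verts G"
  have full_ge: "D \<le> discrepancy G M"
    if "?V \<subseteq> dom M" "ran M \<subseteq> {0, 1}" "zeros ?V M = N" "Q M" for M
  proof (rule final[OF _ that(3,4)])
    show "\<forall>v\<in>?V. M v \<in> {Some 0, Some 1}" using that(1,2) by (fastforce simp: ran_def)
  qed
  show ?case
  proof (cases "?V \<subseteq> dom L")
    case True
    have "Q L" by (rule resp_terminal[OF less.prems(1)]) (use True no_lstep in blast)
    moreover have empty: "?V - dom L = {}" using True by auto
    with less.prems(3) have "zeros ?V L = N" by simp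
    ultimately show ?thesis
      using full_ge[OF True less.prems(2)] empty by (subst game_value.simps) simp
  next
    case False
    have "D \<le> game_value G Impish (L(v \<mapsto> 0))" if "v \<in> ?V - dom L" for v
    proof -
      have v: "v \<in> ?V" "L v = None" using that by auto
      let ?L = "L(v \<mapsto> 0)"
      have ran: "ran ?L \<subseteq> {0, 1}" using less.prems(2) v(2) by auto
      note card = card_free_upd[of ?V v L 0, OF assms(1) v]
      show ?thesis
      proof (cases "?V \<subseteq> dom ?L")
        case True
        have empty: "?V - dom ?L = {}" using True by auto
        with card have "card (?V - dom L) = 1" by (simp only: card.empty)
        with less.prems(3) zeros_upd0[of ?V v L, OF assms(1) v] have "zeros ?V ?L = N" by simp
        from full_ge[OF True ran this resp_full[OF less.prems(1) v True]] show ?thesis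
          using empty by (subst game_value.simps) simp
      next
        case False
        from resp_reply[OF less.prems(1) v mono False] obtain u where
          u: "u \<in> ?V" "?L u = None" "resp (lstep ?V 0) (lstep ?V 1) Q (?L(u \<mapsto> 1))" by blast
        note card' = card_free_upd[of ?V u ?L 1, OF assms(1) u(1,2)]
        have "D \<le> game_value G Admirable (?L(u \<mapsto> 1))"
        proof (rule less.hyps[OF _ u(3)])
          show "ran (?L(u \<mapsto> 1)) \<subseteq> {0, 1}" using ran u(2) by auto
          show "zeros ?V (?L(u \<mapsto> 1)) + Suc (card (?V - dom (?L(u \<mapsto> 1)))) div 2 = N"
            using less.prems(3) card card' zeros_upd0[of ?V v L, OF assms(1) v] zeros_upd1[of ?L u ?V] u(2)
            by simp
        qed (use card card' in linarith)
        moreover have "game_value G Admirable (?L(u \<mapsto> 1)) \<le> game_value G Impish ?L"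
          using assms(1) u(1,2) by (rule game_value_Impish_ge)
        ultimately show ?thesis by linarith
      qed
    qed
    moreover have "?V - dom L \<noteq> {}" using False by auto
    ultimately show ?thesis using assms(1) by (subst game_value.simps) simp
  qed
qed

section \<open>The final discrepancy in terms of the score\<close>

lemma score_scan_snoc:
  "score (mset (scan a k (w @ [Some y, Some x]))) =
     score (mset (scan a k (w @ [Some y]))) - int (lw y) + int (lw y) * int (lw x) + int (lw x)"
proof (induction w arbitrary: a k)
  case (Cons z w)
  then show ?case by (cases z) auto
qed simp

lemma edges_path_graph_Suc:
  assumes "n \<ge> 1"
  shows "edges (path_graph (Suc n)) = insert {n, Suc n} (edges (path_graph n))"
  using assms by (force simp: path_graph_def le_Suc_eq)

lemma finite_edges_path_graph: "finite (edges (path_graph n))"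
proof -
  have "edges (path_graph n) \<subseteq> Pow {1..n}" by (auto simp: path_graph_def)
  then show ?thesis by (rule finite_subset) simp
qed

text \<open>Each vertex labelled 0 has two sides, each facing an edge or an end of the path. So
  twice the number of zeros is twice the number of edges with two zeros, plus the number of mixed
  edges, plus the number of ends labelled 0. The mixed edges are those labelled 1, and e_1 - e_0 = 2
  * e_1 - (n - 1). The induction verifies this by appending one vertex at a time.\<close>

lemma discrepancy_path_graph:
  assumes "n \<ge> 1" "\<forall>v\<in>{1..n}. L v \<in> {Some 0, Some 1}"
  shows "discrepancy (path_graph n) L = 4 * int (zeros {1..n} L) - score (pos n L) - int (n - 1)"
  using assms
proof (induction n rule: nat_induct_at_least)
  \<comment> \<open>A single vertex is both ends of the path, so with label 0 it scores 4.\<close>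
  case base
  then consider "L 1 = Some 0" | "L 1 = Some 1" by auto
  moreover have "edges (path_graph 1) = {}" by (auto simp: path_graph_def)
  moreover have "{v. v = 1 \<and> L v = Some 0} = (if L 1 = Some 0 then {1} else {})" by auto
  ultimately show ?case
    by cases (simp_all add: discrepancy_def zeros_def pos_def lw_def)
next
  case (Suc n)
  let ?E = "edges (path_graph n)" and ?e = "{n, Suc n}"
  obtain y x where yx: "L n = Some y" "L (Suc n) = Some x" "y \<in> {0, 1}" "x \<in> {0, 1}"
  proof -
    have "L n \<in> {Some 0, Some 1}" "L (Suc n) \<in> {Some 0, Some 1}"
      using Suc.prems Suc.hyps by (auto simp del: insert_iff)
    then show thesis using that by blast
  qed
  have new: "?e \<notin> ?E" by (auto simp: path_graph_def doubleton_eq_iff)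
  have card: "card {e \<in> insert ?e ?E. P e} = card {e \<in> ?E. P e} + (if P ?e then 1 else 0)" for P
  proof -
    have "{e \<in> insert ?e ?E. P e} = (if P ?e then insert ?e {e \<in> ?E. P e} else {e \<in> ?E. P e})"
      by auto
    then show ?thesis using new finite_edges_path_graph[of n] by simp
  qed
  have label: "edge_label L ?e = (y + x) mod 2"
    by (simp add: edge_label_def yx)
  have disc: "discrepancy (path_graph (Suc n)) L =
      discrepancy (path_graph n) L + (if y = x then - 1 else 1)"
    unfolding discrepancy_def edges_path_graph_Suc[OF Suc.hyps] card label
    using yx(3,4) by auto
  have word: "map L [1..<Suc (Suc n)] = map L [1..<n] @ [Some y, Some x]"
    "map L [1..<Suc n] = map L [1..<n] @ [Some y]"
    using Suc.hyps yx by auto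
  \<comment> \<open>The former path end at vertex \<open>n\<close> contributed
    \<open>lw y * 1\<close>. It is replaced by the new edge with \<open>lw y * lw x\<close> and the
    new end with \<open>lw x * 1\<close>.\<close>
  have score: "score (pos (Suc n) L) =
      score (pos n L) - int (lw y) + int (lw y) * int (lw x) + int (lw x)"
    unfolding pos_def word by (rule score_scan_snoc)
  have "{v \<in> {1..Suc n}. L v = Some 0} =
      (if x = 0 then insert (Suc n) {v \<in> {1..n}. L v = Some 0} else {v \<in> {1..n}. L v = Some 0})"
    using yx(2) by (auto simp: le_Suc_eq)
  then have zeros: "zeros {1..Suc n} L = zeros {1..n} L + (if x = 0 then 1 else 0)"
    by (simp add: zeros_def)
  show ?case using Suc.IH Suc.prems Suc.hyps yx(3,4) unfolding disc score zeros
    by (auto simp: lw_def)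
qed

section \<open>Long paths from short ones\<close>

lemma maker_join:
  assumes "secures 0 2 1 {#(k, 1, 1)#} c" "secures 0 2 1 {#(l, 1, 1)#} d"
  shows "secures 0 2 1 {#(k + l, 1, 1)#} (c + d - 2)"
  by (rule secures_join[where X = "{#}"]) (use secures_union[OF assms] in \<open>simp_all add: add_mset_commute\<close>)

lemma breaker_join:
  assumes "secures 2 0 (- 1) {#(k, 1, 1)#} c" "secures 2 0 (- 1) {#(l, 1, 1)#} d"
  shows "secures 2 0 (- 1) {#(k + l, 1, 1)#} (c + d)"
  by (rule secures_join[where X = "{#}"]) (use secures_union[OF assms] in \<open>simp_all add: add_mset_commute\<close>)

text \<open>Each block falls at most 2 short of its length and each cut costs another 2. There is
  one cut fewer than there are blocks, which explains the + 2. The remaining block has any even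
  length from 2 to 16, hence the quotient is rounded up.\<close>

lemma maker_even:
  assumes "even n" "n > 0"
  shows "secures 0 2 1 {#(n, 1, 1)#} (int n + 2 - 4 * int ((n + 15) div 16))"
  using assms
proof (induction n rule: less_induct)
  case (less n)
  note P = maker_base
  have P8: "secures 0 2 1 {#(8, 1, 1)#} 6" using maker_join[OF P(2) P(2)] by simp
  have P10: "secures 0 2 1 {#(10, 1, 1)#} 8" using maker_join[OF P(2) P(3)] by simp
  have P12: "secures 0 2 1 {#(12, 1, 1)#} 10" using maker_join[OF P(3) P(3)] by simp
  show ?case
  proof (cases "n \<le> 16")
    case True
    then have "n \<in> {2, 4, 6, 8, 10, 12, 14, 16}" using less.prems by (auto elim!: evenE)
    then show ?thesis using P P8 P10 P12
      by (elim insertE emptyE) (simp_all add: secures_mono[of 0 2 1 _ 2 0] secures_mono[of 0 2 1 _ 4 2]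
          secures_mono[of 0 2 1 _ 6 4])
  next
    case False
    then obtain m where m: "n = m + 16" "m > 0"
      by (metis add.commute less_imp_add_positive not_le)
    with less have *: "secures 0 2 1 {#(m, 1, 1)#} (int m + 2 - 4 * int ((m + 15) div 16))"
      by simp
    have "(m + 16 + 15) div 16 = Suc ((m + 15) div 16)" by presburger
    then show ?thesis
      unfolding m by (intro secures_mono[OF maker_join[OF * P(5)]]) simp
  qed
qed

text \<open>One vertex is cut off and given up: it is worth at least 0, and the cut costs 2. This
  would even give - 1 in place of - 5; the stated constant is the one that matches the + 4 of the
  theorem.\<close>

lemma maker_odd:
  assumes "odd n"
  shows "secures 0 2 1 {#(n, 1, 1)#} (int n - 5 - 4 * int ((n + 15) div 16))"
proof (cases "n = 1")
  case True
  then show ?thesis by (intro secures_mono[OF secures_nonneg]) simp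
next
  case False
  with assms have "even (n - 1)" "n - 1 > 0" by (auto elim: oddE)
  from maker_join[OF maker_even[OF this] secures_nonneg[of 0 2 "{#(1, 1, 1)#}"]] \<open>n - 1 > 0\<close>
  show ?thesis by simp (erule secures_mono, linarith)
qed

text \<open>Since cuts are free for Impish, the path is divided into blocks of 16, each held to 14,
  and pairs of vertices, each held to 2. Only full blocks gain anything over the length, hence the
  quotient is rounded down.\<close>

lemma breaker_even:
  assumes "even n" "n > 0"
  shows "secures 2 0 (- 1) {#(n, 1, 1)#} (- (int n - 2 * int (n div 16)))"
  using assms
proof (induction n rule: less_induct)
  case (less n)
  consider "n = 2" | "n = 16" | "n > 2" "n < 16" | "n > 16" using less.prems by fastforce
  then show ?case
  proof cases
    case 3
    then obtain m where m: "n = m + 2" "m > 0" by (metis add.commute less_imp_add_positive)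
    with less have "secures 2 0 (- 1) {#(m, 1, 1)#} (- (int m - 2 * int (m div 16)))" by simp
    from breaker_join[OF this breaker_base(1)] show ?thesis
      unfolding m by (rule secures_mono) (use 3 m in simp)
  next
    case 4
    then obtain m where m: "n = m + 16" "m > 0" by (metis add.commute less_imp_add_positive)
    with less have "secures 2 0 (- 1) {#(m, 1, 1)#} (- (int m - 2 * int (m div 16)))" by simp
    from breaker_join[OF this breaker_base(2)] show ?thesis
      unfolding m by (rule secures_mono) simp
  qed (use breaker_base in simp_all)
qed

section \<open>The balance game on paths\<close>

lemma scan_None: "scan a k (replicate m None) = [(k + m, a, 1)]"
  using scan_replicate[of a k m "[]"] by simp

lemma pos_empty: "pos n Map.empty = {#(n, 1, 1)#}"
proof -
  have "map Map.empty [1..<Suc n] = (replicate n None :: nat option list)"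
    by (rule nth_equalityI) (simp_all del: upt_Suc)
  then show ?thesis by (simp only: pos_def scan_None) simp
qed

lemma pos_first:
  assumes "n \<ge> 1"
  shows "pos n [1 \<mapsto> 1] = {#(0, 1, 0), (n - 1, 0, 1)#}"
proof -
  have "map [1 \<mapsto> 1] [1..<Suc n] = (Some 1 :: nat option) # replicate (n - 1) None"
    using assms by (intro nth_equalityI) (auto simp: nth_Cons simp del: upt_Suc split: nat.splits)
  then show ?thesis unfolding pos_def by (simp only: scan.simps scan_None) (simp add: lw_def add_mset_commute)
qed

lemma lw_01: "lw 0 = 2" "lw 1 = 0"
  by (simp_all add: lw_def)

lemma verts_path_graph: "verts (path_graph n) = {1..n}"
  by (simp add: path_graph_def)

lemma game_balance_path_le:
  assumes "n \<ge> 1" "secures 0 2 1 {#(n, 1, 1)#} c"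
  shows "game_balance_I (path_graph n) \<le> 4 * int (n div 2) - c - int (n - 1)"
  unfolding game_balance_I_def
proof (rule game_value_le[where Q = "\<lambda>L. c \<le> 1 * score (pos n L)" and N = "n div 2"],
    unfold verts_path_graph)
  fix L :: "nat labeling" and u
  assume "u \<in> {1..n}" "L u = None" "c \<le> 1 * score (pos n (L(u \<mapsto> 1)))"
  then show "c \<le> 1 * score (pos n (L(u \<mapsto> 0)))" using score_pos_mono[of u n L] by simp
next
  fix L :: "nat labeling"
  assume "\<forall>v\<in>{1..n}. L v \<in> {Some 0, Some 1}" "zeros {1..n} L = n div 2" "c \<le> 1 * score (pos n L)"
  then show "discrepancy (path_graph n) L \<le> 4 * int (n div 2) - c - int (n - 1)"
    using discrepancy_path_graph[OF assms(1)] by simp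
next
  show "resp (lstep {1..n} 1) (lstep {1..n} 0) (\<lambda>L. c \<le> 1 * score (pos n L)) Map.empty"
    by (rule resp_labelings) (use assms(2) in \<open>simp only: pos_empty lw_01\<close>)
qed (auto simp: zeros_def)

text \<open>\<open>v\<close> is Impish's opening, after which he is the responder. A strategy is
  demanded only after the opening, so that the opening may be a surplus move or a deliberate
  preparation.\<close>

lemma game_balance_path_ge:
  assumes "v \<in> {1..n}" and resp: "resp (lstep {1..n} 0) (lstep {1..n} 1)
      (\<lambda>L. c \<le> - 1 * score (pos n L)) [v \<mapsto> 1]"
  shows "4 * int (n div 2) + c - int (n - 1) \<le> game_balance_I (path_graph n)"
proof -
  have "4 * int (n div 2) + c - int (n - 1) \<le> game_value (path_graph n) Admirable [v \<mapsto> 1]"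
  proof (rule game_value_ge[where Q = "\<lambda>L. c \<le> - 1 * score (pos n L)" and N = "n div 2"],
      unfold verts_path_graph)
    fix L :: "nat labeling" and u
    assume "u \<in> {1..n}" "L u = None" "c \<le> - 1 * score (pos n (L(u \<mapsto> 0)))"
    then show "c \<le> - 1 * score (pos n (L(u \<mapsto> 1)))" using score_pos_mono[of u n L] by simp
  next
    fix L :: "nat labeling"
    assume "\<forall>v\<in>{1..n}. L v \<in> {Some 0, Some 1}" "zeros {1..n} L = n div 2"
      "c \<le> - 1 * score (pos n L)"
    then show "4 * int (n div 2) + c - int (n - 1) \<le> discrepancy (path_graph n) L"
      using discrepancy_path_graph[of n L] assms(1) by simp
  next
    have "zeros {1..n} [v \<mapsto> 1] = 0" by (auto simp: zeros_def)
    moreover have "card ({1..n} - dom [v \<mapsto> 1]) = n - 1" using assms(1) by simp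
    \<comment> \<open>Admirable moves next with n - 1 vertices free; half of them rounded up is n
      div 2.\<close>
    ultimately show "zeros {1..n} [v \<mapsto> 1] + Suc (card ({1..n} - dom [v \<mapsto> 1])) div 2 = n div 2"
      using assms(1) by simp
  qed (use resp in auto)
  also have "\<dots> \<le> game_balance_I (path_graph n)"
    unfolding game_balance_I_def by (rule game_value_Impish_ge) (use assms(1) in \<open>auto simp: verts_path_graph\<close>)
  finally show ?thesis .
qed

text \<open>A label 1 beside the remaining path is no better for Admirable than a free path end: the
  segment \<open>(n - 1, 0, 1)\<close> arises by joining the worthless empty piece
  \<open>(0, 0, 1)\<close> to a whole path of even length n - 1, and joining does not raise the
  bound on S. Since n is odd, n - 1 and n have the same quotient by 16.\<close>

lemma breaker_after_first:
  assumes "odd n"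
  shows "secures 2 0 (- 1) {#(0, 1, 0), (n - 1, 0, 1)#} (- (int n - 1 - 2 * int (n div 16)))"
proof (cases "n = 1")
  case True
  then show ?thesis using secures_leaf[of "{#(0, 1, 0), (0, 0, 1)#}" 2 0 "- 1"] by simp
next
  case False
  with assms have n: "even (n - 1)" "n - 1 > 0" by (auto elim: oddE)
  have "(n - 1) div 16 = n div 16" using assms by (elim oddE) simp
  with breaker_even[OF n] n have "secures 2 0 (- 1) {#(n - 1, 1, 1)#} (- (int n - 1 - 2 * int (n div 16)))"
    by (simp add: of_nat_diff)
  from secures_union[OF secures_leaf[of "{#(0, 1, 0), (0, 0, 1)#}" 2 0 "- 1"] this]
  have "secures 2 0 (- 1) (add_mset (0, 0, 1) (add_mset (n - 1, 1, 1) {#(0, 1, 0)#}))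
      (- (int n - 1 - 2 * int (n div 16)))"
    by (simp add: add_mset_commute)
  from secures_join[OF this] show ?thesis by (simp add: add_mset_commute)
qed

theorem theorem4p7:
  fixes n :: nat
  assumes "n \<ge> 1"
  shows "(even n \<longrightarrow>
            2 * \<lfloor>real n / 16\<rfloor> - 5 \<le> game_balance_I (path_graph n) \<and>
            game_balance_I (path_graph n) \<le> 4 * \<lceil>real n / 16\<rceil> - 1) \<and>
         (odd n \<longrightarrow>
            2 * \<lfloor>real n / 16\<rfloor> \<le> game_balance_I (path_graph n) \<and>
            game_balance_I (path_graph n) \<le> 4 * \<lceil>real n / 16\<rceil> + 4)"
proof -
  have floor: "\<lfloor>real n / 16\<rfloor> = int (n div 16)"
    using floor_divide_of_nat_eq[of n 16] by simp
  have "real n \<le> 16 * real ((n + 15) div 16)" "16 * real ((n + 15) div 16) < real n + 16"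
    by linarith+
  then have ceiling: "\<lceil>real n / 16\<rceil> = int ((n + 15) div 16)"
    by (intro ceiling_unique) auto
  have V: "1 \<in> {1..n}" using assms by simp
  show ?thesis unfolding floor ceiling
  proof (intro conjI impI)
    assume "even n"
    then have n: "even n" "n > 0" "4 * int (n div 2) = 2 * int n" using assms by auto
    show "game_balance_I (path_graph n) \<le> 4 * int ((n + 15) div 16) - 1"
      using game_balance_path_le[OF assms maker_even[OF n(1,2)]] n by linarith
    \<comment> \<open>On the untouched path this is Impish's guarantee as second player. His actual
      opening is then a surplus move, and vertex 1 is an arbitrary choice for it.\<close>
    have "resp (lstep {1..n} 0) (lstep {1..n} 1)
        (\<lambda>L. - (int n - 2 * int (n div 16)) \<le> - 1 * score (pos n L)) Map.empty"
      by (rule resp_labelings) (use breaker_even[OF n(1,2)] in \<open>simp only: pos_empty lw_01\<close>)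
    then have "resp (lstep {1..n} 0) (lstep {1..n} 1)
        (\<lambda>L. - (int n - 2 * int (n div 16)) \<le> - 1 * score (pos n L)) [1 \<mapsto> 1]"
    proof (rule resp_extra_move[OF _ V])
      fix L :: "nat labeling" and u
      assume "u \<in> {1..n}" "L u = None"
      from score_pos_mono[of u n L, OF this]
      show "- (int n - 2 * int (n div 16)) \<le> - 1 * score (pos n (L(u \<mapsto> 0))) \<Longrightarrow>
          - (int n - 2 * int (n div 16)) \<le> - 1 * score (pos n (L(u \<mapsto> 1)))"
        by linarith
    qed simp
    \<comment> \<open>The strategy yields 2 * (n div 16) + 1, which is more than the bound
      claimed.\<close>
    from game_balance_path_ge[OF V this] n
    show "2 * int (n div 16) - 5 \<le> game_balance_I (path_graph n)" by linarith
  next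
    assume n: "odd n"
    then have half: "4 * int (n div 2) = 2 * int n - 2" by (elim oddE) simp
    show "game_balance_I (path_graph n) \<le> 4 * int ((n + 15) div 16) + 4"
      using game_balance_path_le[OF assms maker_odd[OF n]] half assms by linarith
    \<comment> \<open>For odd n the opening is put to use: a 1 on an end vertex leaves an even
      number of vertices, on which the block strategy applies.\<close>
    have "resp (lstep {1..n} 0) (lstep {1..n} 1)
        (\<lambda>L. - (int n - 1 - 2 * int (n div 16)) \<le> - 1 * score (pos n L)) [1 \<mapsto> 1]"
      by (rule resp_labelings)
        (use breaker_after_first[OF n] in \<open>simp only: pos_first[OF assms] lw_01\<close>)
    from game_balance_path_ge[OF V this] half assms
    show "2 * int (n div 16) \<le> game_balance_I (path_graph n)" by linarith
  qed
qed

end
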